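(* Every finitely presented abelian lattice-ordered group, viewed as a partially ordered abelian group (that is, as a partially ordered $\mathbb{Z}$-module), is po-coherent.
   Context: An abelian lattice-ordered group is finitely presented if it is isomorphic to a quotient $\mathrm{FA}(n)/I$, where $n$ is a positive integer, $\mathrm{FA}(n)$ is the free abelian lattice-ordered group on $n$ generators, and $I$ is a finitely generated $\ell$-ideal of $\mathrm{FA}(n)$ (an $\ell$-ideal is a convex subgroup closed under $\wedge$ and $\vee$). A partially ordered abelian group $A$ is po-coherent (as a partially ordered module over $\mathbb{Z}$ with its natural ordering) if for every integer $n\geq 1$ and all $a_1,\dots,a_n\in A$, the set of all $(\xi_1,\dots,\xi_n)\in(\mathbb{Z}^+)^n$ such that $a_1\xi_1+\cdots+a_n\xi_n\geq 0$ is a finitely generated submonoid of $\mathbb{Z}^n$, where $\mathbb{Z}^+=\{0,1,2,\dots\}$. *)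

theory Defs
  imports "HOL.Hull" "HOL-Algebra.FiniteProduct" "HOL-Algebra.Product_Groups"
    "HOL-Algebra.Lattice"
begin

section \<open>Partially ordered and lattice-ordered abelian groups\<close>

text \<open>
  Groups are written multiplicatively, as in HOL-Algebra: the sum of two elements is
  \<open>x \<otimes> y\<close>, zero is \<open>\<one>\<close>, and the integer multiple of \<open>x\<close> by \<open>k\<close> is \<open>x [^] k\<close>.
\<close>

record 'a po_group = "'a monoid" +
  leq :: "'a \<Rightarrow> 'a \<Rightarrow> bool"  (infixl \<open>\<preceq>\<index>\<close> 50)

definition po_of :: "('a, 'b) po_group_scheme \<Rightarrow> 'a gorder"
  where "po_of G = \<lparr>carrier = carrier G, eq = (=), le = leq G\<rparr>"

locale po_comm_group = comm_group G + partial_order "po_of G" for G (structure) +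
  assumes leq_mult_left:
    "\<lbrakk>x \<in> carrier G; y \<in> carrier G; z \<in> carrier G; x \<preceq> y\<rbrakk> \<Longrightarrow> z \<otimes> x \<preceq> z \<otimes> y"

locale comm_lgroup = po_comm_group + lattice "po_of G"

definition lgroup_hom ::
  "('a, 'c) po_group_scheme \<Rightarrow> ('b, 'd) po_group_scheme \<Rightarrow> ('a \<Rightarrow> 'b) set"
  where "lgroup_hom G H =
    {h \<in> hom G H. join_pres (po_of G) (po_of H) h \<and> meet_pres (po_of G) (po_of H) h}"

definition lgroup_isomorphic ::
  "('a, 'c) po_group_scheme \<Rightarrow> ('b, 'd) po_group_scheme \<Rightarrow> bool"
  where "lgroup_isomorphic G H \<longleftrightarrow>
    (\<exists>h \<in> lgroup_hom G H. bij_betw h (carrier G) (carrier H))"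

definition l_ideal :: "'a set \<Rightarrow> ('a, 'b) po_group_scheme \<Rightarrow> bool"
  where "l_ideal I G \<longleftrightarrow> subgroup I G \<and>
    (\<forall>x \<in> I. \<forall>z \<in> I. \<forall>y \<in> carrier G. x \<preceq>\<^bsub>G\<^esub> y \<and> y \<preceq>\<^bsub>G\<^esub> z \<longrightarrow> y \<in> I) \<and>
    (\<forall>x \<in> I. \<forall>y \<in> I. x \<sqinter>\<^bsub>po_of G\<^esub> y \<in> I \<and> x \<squnion>\<^bsub>po_of G\<^esub> y \<in> I)"

definition fin_gen_l_ideal :: "'a set \<Rightarrow> ('a, 'b) po_group_scheme \<Rightarrow> bool"
  where "fin_gen_l_ideal I G \<longleftrightarrow>
    (\<exists>S. finite S \<and> S \<subseteq> carrier G \<and> I = (\<lambda>J. l_ideal J G) hull S)"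

text \<open>
  The quotient order: \<open>I #> x\<close> lies below \<open>I #> y\<close> iff some representatives do. For an
  \<open>\<ell>\<close>-ideal this is a lattice-ordered group (\<open>quot_comm_lgroup\<close> below).
\<close>

definition quot_lgroup :: "('a, 'b) po_group_scheme \<Rightarrow> 'a set \<Rightarrow> 'a set po_group"
  where "quot_lgroup G I =
    \<lparr>carrier = carrier (G Mod I), mult = mult (G Mod I), one = one (G Mod I),
     leq = (\<lambda>X Y. \<exists>x \<in> X. \<exists>y \<in> Y. x \<preceq>\<^bsub>G\<^esub> y)\<rparr>"


section \<open>Free abelian lattice-ordered groups\<close>

text \<open>
  The free abelian lattice-ordered group is the algebra of terms modulo the equations
  derivable from the axioms of the variety; \<open>FA_comm_lgroup\<close> and \<open>FA_universal\<close> below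
  confirm that this has the universal property.
\<close>

datatype (gens: 'x) lterm =
    Gen 'x
  | Zer
  | Neg "'x lterm"
  | Add "'x lterm" "'x lterm"
  | Meet "'x lterm" "'x lterm"
  | Join "'x lterm" "'x lterm"

inductive lterm_eq :: "'x lterm \<Rightarrow> 'x lterm \<Rightarrow> bool"  (infix \<open>\<sim>\<close> 50)
  where
    refl: "t \<sim> t"
  | sym: "s \<sim> t \<Longrightarrow> t \<sim> s"
  | trans: "s \<sim> t \<Longrightarrow> t \<sim> u \<Longrightarrow> s \<sim> u"
  | Neg_cong: "s \<sim> t \<Longrightarrow> Neg s \<sim> Neg t"
  | Add_cong: "s \<sim> s' \<Longrightarrow> t \<sim> t' \<Longrightarrow> Add s t \<sim> Add s' t'"
  | Meet_cong: "s \<sim> s' \<Longrightarrow> t \<sim> t' \<Longrightarrow> Meet s t \<sim> Meet s' t'"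
  | Join_cong: "s \<sim> s' \<Longrightarrow> t \<sim> t' \<Longrightarrow> Join s t \<sim> Join s' t'"
  | Add_assoc: "Add (Add s t) u \<sim> Add s (Add t u)"
  | Add_comm: "Add s t \<sim> Add t s"
  | Add_Zer: "Add Zer t \<sim> t"
  | Add_Neg: "Add (Neg t) t \<sim> Zer"
  | Meet_assoc: "Meet (Meet s t) u \<sim> Meet s (Meet t u)"
  | Meet_comm: "Meet s t \<sim> Meet t s"
  | Join_assoc: "Join (Join s t) u \<sim> Join s (Join t u)"
  | Join_comm: "Join s t \<sim> Join t s"
  | Meet_Join: "Meet s (Join s t) \<sim> s"
  | Join_Meet: "Join s (Meet s t) \<sim> s"
  | Add_Meet: "Add s (Meet t u) \<sim> Meet (Add s t) (Add s u)"
  | Add_Join: "Add s (Join t u) \<sim> Join (Add s t) (Add s u)"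

definition lterms :: "nat \<Rightarrow> nat lterm set"
  where "lterms n = {t. gens t \<subseteq> {..<n}}"

definition lterm_rel :: "nat \<Rightarrow> (nat lterm \<times> nat lterm) set"
  where "lterm_rel n = {(s, t). s \<in> lterms n \<and> t \<in> lterms n \<and> s \<sim> t}"

definition lclass :: "nat \<Rightarrow> nat lterm \<Rightarrow> nat lterm set"
  where "lclass n t = lterm_rel n `` {t}"

definition FA :: "nat \<Rightarrow> nat lterm set po_group"
  where "FA n =
    \<lparr>carrier = lterms n // lterm_rel n,
     mult = (\<lambda>X Y. \<Union>s \<in> X. \<Union>t \<in> Y. lclass n (Add s t)),
     one = lclass n Zer,
     leq = (\<lambda>X Y. \<exists>s \<in> X. \<exists>t \<in> Y. Meet s t \<sim> s)\<rparr>"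

definition finitely_presented :: "('a, 'b) po_group_scheme \<Rightarrow> bool"
  where "finitely_presented A \<longleftrightarrow>
    (\<exists>n \<ge> 1. \<exists>I. fin_gen_l_ideal I (FA n) \<and> lgroup_isomorphic A (quot_lgroup (FA n) I))"


section \<open>Po-coherence\<close>

text \<open>
  \<open>\<int>\<^sup>n\<close> consists of the functions on \<open>{..<n}\<close>, extended by \<open>undefined\<close>.
\<close>

abbreviation int_power_group :: "nat \<Rightarrow> (nat \<Rightarrow> int) monoid"
  where "int_power_group n \<equiv> product_group {..<n} (\<lambda>_. integer_group)"

definition fin_gen_submonoid :: "'a set \<Rightarrow> ('a, 'b) monoid_scheme \<Rightarrow> bool"
  where "fin_gen_submonoid H M \<longleftrightarrow>
    (\<exists>S. finite S \<and> S \<subseteq> carrier M \<and> H = (\<lambda>K. submonoid K M) hull S)"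

definition po_coherent :: "('a, 'b) po_group_scheme \<Rightarrow> bool"
  where "po_coherent A \<longleftrightarrow>
    (\<forall>n \<ge> 1. \<forall>a \<in> {..<n} \<rightarrow> carrier A.
      fin_gen_submonoid
        {\<xi> \<in> carrier (int_power_group n).
          (\<forall>i<n. 0 \<le> \<xi> i) \<and> \<one>\<^bsub>A\<^esub> \<preceq>\<^bsub>A\<^esub> (\<Otimes>\<^bsub>A\<^esub>i\<in>{..<n}. a i [^]\<^bsub>A\<^esub> \<xi> i)}
        (int_power_group n))"


section \<open>The constructions yield lattice-ordered groups\<close>

lemma lterms_simps [simp]:
  "Gen i \<in> lterms n \<longleftrightarrow> i < n" "Zer \<in> lterms n" "Neg t \<in> lterms n \<longleftrightarrow> t \<in> lterms n"
  "Add s t \<in> lterms n \<longleftrightarrow> s \<in> lterms n \<and> t \<in> lterms n"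
  "Meet s t \<in> lterms n \<longleftrightarrow> s \<in> lterms n \<and> t \<in> lterms n"
  "Join s t \<in> lterms n \<longleftrightarrow> s \<in> lterms n \<and> t \<in> lterms n"
  by (auto simp: lterms_def)

lemma equiv_lterm_rel: "equiv (lterms n) (lterm_rel n)"
  by (auto simp: equiv_def refl_on_def sym_def trans_def lterm_rel_def
      intro: lterm_eq.intros)

lemma lclass_eq_iff:
  "s \<in> lterms n \<Longrightarrow> t \<in> lterms n \<Longrightarrow> lclass n s = lclass n t \<longleftrightarrow> s \<sim> t"
  using eq_equiv_class_iff[OF equiv_lterm_rel] by (auto simp: lclass_def lterm_rel_def)

lemma mem_lclass_iff: "s \<in> lclass n t \<longleftrightarrow> t \<in> lterms n \<and> s \<in> lterms n \<and> t \<sim> s"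
  by (auto simp: lclass_def lterm_rel_def)

lemma carrier_FA: "carrier (FA n) = lclass n ` lterms n"
  by (auto simp: FA_def quotient_def lclass_def)

lemma one_FA: "\<one>\<^bsub>FA n\<^esub> = lclass n Zer"
  by (simp add: FA_def)

lemma mult_FA:
  assumes "s \<in> lterms n" "t \<in> lterms n"
  shows "lclass n s \<otimes>\<^bsub>FA n\<^esub> lclass n t = lclass n (Add s t)"
proof -
  have *: "lclass n (Add s' t') = lclass n (Add s t)"
    if "s' \<in> lclass n s" "t' \<in> lclass n t" for s' t'
  proof -
    have "s' \<in> lterms n" "t' \<in> lterms n" "s' \<sim> s" "t' \<sim> t"
      using that unfolding mem_lclass_iff by (blast intro: lterm_eq.sym)+
    with assms show ?thesis
      by (subst lclass_eq_iff) (auto intro: lterm_eq.Add_cong)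
  qed
  have "s \<in> lclass n s" "t \<in> lclass n t"
    using assms unfolding mem_lclass_iff by (blast intro: lterm_eq.refl)+
  with * show ?thesis
    unfolding FA_def monoid.simps by blast
qed

lemma leq_FA:
  assumes "s \<in> lterms n" "t \<in> lterms n"
  shows "lclass n s \<preceq>\<^bsub>FA n\<^esub> lclass n t \<longleftrightarrow> Meet s t \<sim> s"
proof -
  have "Meet s t \<sim> s" if "s \<sim> s'" "t \<sim> t'" "Meet s' t' \<sim> s'" for s' t'
    by (rule lterm_eq.trans[OF lterm_eq.Meet_cong[OF that(1,2)]
          lterm_eq.trans[OF that(3) lterm_eq.sym[OF that(1)]]])
  moreover have "s \<in> lclass n s" "t \<in> lclass n t"
    using assms by (simp_all add: mem_lclass_iff lterm_eq.refl)
  moreover have "lclass n s \<preceq>\<^bsub>FA n\<^esub> lclass n t \<longleftrightarrow>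
      (\<exists>s' \<in> lclass n s. \<exists>t' \<in> lclass n t. Meet s' t' \<sim> s')"
    by (simp add: FA_def)
  ultimately show ?thesis
    using mem_lclass_iff by blast
qed

lemmas [trans] = lterm_eq.trans

lemma Meet_idem: "Meet t t \<sim> t"
  by (rule lterm_eq.trans[OF lterm_eq.Meet_cong[OF lterm_eq.refl
        lterm_eq.sym[OF lterm_eq.Join_Meet]] lterm_eq.Meet_Join])

lemma Meet_eq_iff_Join_eq: "Meet s t \<sim> s \<longleftrightarrow> Join s t \<sim> t"
proof
  assume *: "Meet s t \<sim> s"
  have "Join s t \<sim> Join (Meet s t) t"
    by (intro lterm_eq.Join_cong lterm_eq.sym[OF *] lterm_eq.refl)
  also have "\<dots> \<sim> Join t (Meet s t)"
    by (rule lterm_eq.Join_comm)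
  also have "\<dots> \<sim> Join t (Meet t s)"
    by (intro lterm_eq.Join_cong lterm_eq.refl lterm_eq.Meet_comm)
  also have "\<dots> \<sim> t"
    by (rule lterm_eq.Join_Meet)
  finally show "Join s t \<sim> t" .
next
  assume *: "Join s t \<sim> t"
  have "Meet s t \<sim> Meet s (Join s t)"
    by (intro lterm_eq.Meet_cong lterm_eq.sym[OF *] lterm_eq.refl)
  also have "\<dots> \<sim> s"
    by (rule lterm_eq.Meet_Join)
  finally show "Meet s t \<sim> s" .
qed

lemma Meet_eq_antisym: "Meet s t \<sim> s \<Longrightarrow> Meet t s \<sim> t \<Longrightarrow> s \<sim> t"
  by (meson lterm_eq.Meet_comm lterm_eq.sym lterm_eq.trans)

lemma Meet_eq_trans:
  assumes "Meet s t \<sim> s" "Meet t u \<sim> t"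
  shows "Meet s u \<sim> s"
proof -
  have "Meet s u \<sim> Meet (Meet s t) u"
    by (intro lterm_eq.Meet_cong lterm_eq.sym[OF assms(1)] lterm_eq.refl)
  also have "\<dots> \<sim> Meet s (Meet t u)"
    by (rule lterm_eq.Meet_assoc)
  also have "\<dots> \<sim> Meet s t"
    by (intro lterm_eq.Meet_cong assms lterm_eq.refl)
  also note assms(1)
  finally show ?thesis .
qed

lemma Meet_lower: "Meet (Meet s t) s \<sim> Meet s t" "Meet (Meet s t) t \<sim> Meet s t"
proof -
  have "Join (Meet s t) s \<sim> s"
    by (rule lterm_eq.trans[OF lterm_eq.Join_comm lterm_eq.Join_Meet])
  then show "Meet (Meet s t) s \<sim> Meet s t"
    by (simp add: Meet_eq_iff_Join_eq)
  have "Meet (Meet s t) t \<sim> Meet s (Meet t t)"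
    by (rule lterm_eq.Meet_assoc)
  also have "\<dots> \<sim> Meet s t"
    by (intro lterm_eq.Meet_cong lterm_eq.refl Meet_idem)
  finally show "Meet (Meet s t) t \<sim> Meet s t" .
qed

lemma Join_upper: "Meet s (Join s t) \<sim> s" "Meet t (Join s t) \<sim> t"
proof -
  show "Meet s (Join s t) \<sim> s"
    by (rule lterm_eq.Meet_Join)
  have "Meet t (Join s t) \<sim> Meet t (Join t s)"
    by (intro lterm_eq.Meet_cong lterm_eq.refl lterm_eq.Join_comm)
  also have "\<dots> \<sim> t"
    by (rule lterm_eq.Meet_Join)
  finally show "Meet t (Join s t) \<sim> t" .
qed

lemma Meet_greatest:
  assumes "Meet u s \<sim> u" "Meet u t \<sim> u"
  shows "Meet u (Meet s t) \<sim> u"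
proof -
  have "Meet u (Meet s t) \<sim> Meet (Meet u s) t"
    by (rule lterm_eq.sym[OF lterm_eq.Meet_assoc])
  also have "\<dots> \<sim> Meet u t"
    by (intro lterm_eq.Meet_cong lterm_eq.refl assms)
  also note assms(2)
  finally show ?thesis .
qed

lemma Join_least:
  assumes "Meet s u \<sim> s" "Meet t u \<sim> t"
  shows "Meet (Join s t) u \<sim> Join s t"
proof -
  have *: "Join s u \<sim> u" "Join t u \<sim> u"
    using assms by (simp_all add: Meet_eq_iff_Join_eq)
  have "Join (Join s t) u \<sim> Join s (Join t u)"
    by (rule lterm_eq.Join_assoc)
  also have "\<dots> \<sim> Join s u"
    by (intro lterm_eq.Join_cong lterm_eq.refl *)
  also note *(1)
  finally show ?thesis
    by (simp add: Meet_eq_iff_Join_eq)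
qed

lemma po_of_simps [simp]:
  "carrier (po_of G) = carrier G" "(.=\<^bsub>po_of G\<^esub>) = (=)" "(\<sqsubseteq>\<^bsub>po_of G\<^esub>) = leq G"
  by (simp_all add: po_of_def)

lemma comm_lgroupI:
  fixes G (structure)
  assumes "comm_group G"
    and refl: "\<And>x. x \<in> carrier G \<Longrightarrow> x \<preceq> x"
    and antisym: "\<And>x y. \<lbrakk>x \<in> carrier G; y \<in> carrier G; x \<preceq> y; y \<preceq> x\<rbrakk> \<Longrightarrow> x = y"
    and trans: "\<And>x y z. \<lbrakk>x \<in> carrier G; y \<in> carrier G; z \<in> carrier G; x \<preceq> y; y \<preceq> z\<rbrakk>
      \<Longrightarrow> x \<preceq> z"
    and mono: "\<And>x y z. \<lbrakk>x \<in> carrier G; y \<in> carrier G; z \<in> carrier G; x \<preceq> y\<rbrakk>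
      \<Longrightarrow> z \<otimes> x \<preceq> z \<otimes> y"
    and lub: "\<And>x y. \<lbrakk>x \<in> carrier G; y \<in> carrier G\<rbrakk> \<Longrightarrow>
      \<exists>s. least (po_of G) s (Upper (po_of G) {x, y})"
    and glb: "\<And>x y. \<lbrakk>x \<in> carrier G; y \<in> carrier G\<rbrakk> \<Longrightarrow>
      \<exists>s. greatest (po_of G) s (Lower (po_of G) {x, y})"
  shows "comm_lgroup G"
proof -
  interpret comm_group G by fact
  interpret po: partial_order "po_of G"
    by unfold_locales (auto intro: refl antisym trans)
  show ?thesis
    by unfold_locales (auto intro: mono lub glb)
qed

lemma comm_group_FA: "comm_group (FA n)"
proof (rule comm_groupI)
  show "\<exists>y \<in> carrier (FA n). y \<otimes>\<^bsub>FA n\<^esub> x = \<one>\<^bsub>FA n\<^esub>" if x: "x \<in> carrier (FA n)" for x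
  proof -
    obtain t where "t \<in> lterms n" "x = lclass n t"
      using x by (auto simp: carrier_FA)
    then show ?thesis
      by (intro bexI[of _ "lclass n (Neg t)"])
        (auto simp: carrier_FA mult_FA one_FA lclass_eq_iff intro: lterm_eq.Add_Neg)
  qed
qed (auto simp: carrier_FA mult_FA one_FA lclass_eq_iff del: equalityI
    intro: lterm_eq.Add_assoc lterm_eq.Add_comm lterm_eq.Add_Zer)

lemma least_FA:
  assumes "s \<in> lterms n" "t \<in> lterms n"
  shows "least (po_of (FA n)) (lclass n (Join s t))
    (Upper (po_of (FA n)) {lclass n s, lclass n t})"
proof -
  have "lclass n (Join s t) \<in> carrier (FA n)"
    using assms by (simp add: carrier_FA)
  moreover have "lclass n s \<preceq>\<^bsub>FA n\<^esub> lclass n (Join s t)" "lclass n t \<preceq>\<^bsub>FA n\<^esub> lclass n (Join s t)"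
    using assms by (simp_all add: leq_FA Join_upper)
  moreover have "lclass n (Join s t) \<preceq>\<^bsub>FA n\<^esub> z"
    if "z \<in> carrier (FA n)" "lclass n s \<preceq>\<^bsub>FA n\<^esub> z" "lclass n t \<preceq>\<^bsub>FA n\<^esub> z" for z
  proof -
    obtain u where "u \<in> lterms n" "z = lclass n u"
      using \<open>z \<in> carrier (FA n)\<close> unfolding carrier_FA by blast
    with assms that show ?thesis
      by (simp add: leq_FA Join_least)
  qed
  moreover have "lclass n s \<in> carrier (FA n)" "lclass n t \<in> carrier (FA n)"
    using assms by (simp_all add: carrier_FA)
  ultimately show ?thesis
    unfolding least_def Upper_def po_of_simps by blast
qed

lemma greatest_FA:
  assumes "s \<in> lterms n" "t \<in> lterms n"
  shows "greatest (po_of (FA n)) (lclass n (Meet s t))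
    (Lower (po_of (FA n)) {lclass n s, lclass n t})"
proof -
  have "lclass n (Meet s t) \<in> carrier (FA n)"
    using assms by (simp add: carrier_FA)
  moreover have "lclass n (Meet s t) \<preceq>\<^bsub>FA n\<^esub> lclass n s" "lclass n (Meet s t) \<preceq>\<^bsub>FA n\<^esub> lclass n t"
    using assms by (simp_all add: leq_FA Meet_lower)
  moreover have "z \<preceq>\<^bsub>FA n\<^esub> lclass n (Meet s t)"
    if "z \<in> carrier (FA n)" "z \<preceq>\<^bsub>FA n\<^esub> lclass n s" "z \<preceq>\<^bsub>FA n\<^esub> lclass n t" for z
  proof -
    obtain u where "u \<in> lterms n" "z = lclass n u"
      using \<open>z \<in> carrier (FA n)\<close> unfolding carrier_FA by blast
    with assms that show ?thesis
      by (simp add: leq_FA Meet_greatest)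
  qed
  moreover have "lclass n s \<in> carrier (FA n)" "lclass n t \<in> carrier (FA n)"
    using assms by (simp_all add: carrier_FA)
  ultimately show ?thesis
    unfolding greatest_def Lower_def po_of_simps by blast
qed

theorem FA_comm_lgroup: "comm_lgroup (FA n)"
proof (rule comm_lgroupI)
  show "comm_group (FA n)"
    by (rule comm_group_FA)
next
  fix x y z
  assume *: "x \<in> carrier (FA n)" "y \<in> carrier (FA n)" "z \<in> carrier (FA n)" "x \<preceq>\<^bsub>FA n\<^esub> y"
  then obtain s t u where
    "s \<in> lterms n" "t \<in> lterms n" "u \<in> lterms n" "x = lclass n s" "y = lclass n t" "z = lclass n u"
    by (auto simp: carrier_FA)
  moreover have "Meet (Add u s) (Add u t) \<sim> Add u s" if "Meet s t \<sim> s"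
    by (rule lterm_eq.trans[OF lterm_eq.sym[OF lterm_eq.Add_Meet]
          lterm_eq.Add_cong[OF lterm_eq.refl that]])
  ultimately show "z \<otimes>\<^bsub>FA n\<^esub> x \<preceq>\<^bsub>FA n\<^esub> z \<otimes>\<^bsub>FA n\<^esub> y"
    using * by (simp add: mult_FA leq_FA)
next
  fix x y
  assume "x \<in> carrier (FA n)" "y \<in> carrier (FA n)"
  then show "\<exists>s. least (po_of (FA n)) s (Upper (po_of (FA n)) {x, y})"
    and "\<exists>s. greatest (po_of (FA n)) s (Lower (po_of (FA n)) {x, y})"
    unfolding carrier_FA using least_FA greatest_FA by blast+
qed (auto simp: carrier_FA leq_FA lclass_eq_iff Meet_idem del: equalityI
    intro: Meet_eq_antisym Meet_eq_trans)

interpretation FA: comm_lgroup "FA n" for n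
  by (rule FA_comm_lgroup)

lemma join_FA:
  assumes "s \<in> lterms n" "t \<in> lterms n"
  shows "lclass n s \<squnion>\<^bsub>po_of (FA n)\<^esub> lclass n t = lclass n (Join s t)"
proof -
  have "least (po_of (FA n)) (lclass n s \<squnion>\<^bsub>po_of (FA n)\<^esub> lclass n t)
      (Upper (po_of (FA n)) {lclass n s, lclass n t})"
    using assms unfolding join_def by (intro FA.sup_of_two_least) (auto simp: carrier_FA)
  then show ?thesis
    using least_FA[OF assms] FA.least_unique by blast
qed

lemma meet_FA:
  assumes "s \<in> lterms n" "t \<in> lterms n"
  shows "lclass n s \<sqinter>\<^bsub>po_of (FA n)\<^esub> lclass n t = lclass n (Meet s t)"
proof -
  have "greatest (po_of (FA n)) (lclass n s \<sqinter>\<^bsub>po_of (FA n)\<^esub> lclass n t)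
      (Lower (po_of (FA n)) {lclass n s, lclass n t})"
    using assms unfolding meet_def by (intro FA.inf_of_two_greatest) (auto simp: carrier_FA)
  then show ?thesis
    using greatest_FA[OF assms] FA.greatest_unique by blast
qed

context comm_lgroup
begin

abbreviation gmeet (infixl \<open>\<and>\<^sub>G\<close> 70) where "x \<and>\<^sub>G y \<equiv> x \<sqinter>\<^bsub>po_of G\<^esub> y"
abbreviation gjoin (infixl \<open>\<or>\<^sub>G\<close> 65) where "x \<or>\<^sub>G y \<equiv> x \<squnion>\<^bsub>po_of G\<^esub> y"

lemmas gclosed [simp] = meet_closed[simplified] join_closed[simplified]

lemma leq_mult_cancel:
  assumes "x \<in> carrier G" "y \<in> carrier G" "z \<in> carrier G"
  shows "z \<otimes> x \<preceq> z \<otimes> y \<longleftrightarrow> x \<preceq> y"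
proof
  assume "z \<otimes> x \<preceq> z \<otimes> y"
  then have "inv z \<otimes> (z \<otimes> x) \<preceq> inv z \<otimes> (z \<otimes> y)"
    using assms by (intro leq_mult_left[of "z \<otimes> x" "z \<otimes> y"]) auto
  then show "x \<preceq> y"
    using assms by (simp add: m_assoc[symmetric])
qed (use assms leq_mult_left in auto)

lemma leq_inv_mult:
  assumes "x \<in> carrier G" "y \<in> carrier G" "z \<in> carrier G"
  shows "x \<preceq> inv z \<otimes> y \<longleftrightarrow> z \<otimes> x \<preceq> y" and "inv z \<otimes> y \<preceq> x \<longleftrightarrow> y \<preceq> z \<otimes> x"
  using leq_mult_cancel[of x "inv z \<otimes> y" z] leq_mult_cancel[of "inv z \<otimes> y" x z] assms
  by (simp_all add: m_assoc[symmetric])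

lemma mult_meet_distrib:
  assumes "x \<in> carrier G" "y \<in> carrier G" "z \<in> carrier G"
  shows "x \<otimes> (y \<and>\<^sub>G z) = (x \<otimes> y) \<and>\<^sub>G (x \<otimes> z)"
proof (rule le_antisym[simplified])
  show "x \<otimes> (y \<and>\<^sub>G z) \<preceq> (x \<otimes> y) \<and>\<^sub>G (x \<otimes> z)"
    using assms meet_left[of y z] meet_right[of y z]
    by (intro meet_le[simplified] leq_mult_left) auto
  have "inv x \<otimes> ((x \<otimes> y) \<and>\<^sub>G (x \<otimes> z)) \<preceq> y \<and>\<^sub>G z"
    using assms meet_left[of "x \<otimes> y" "x \<otimes> z"] meet_right[of "x \<otimes> y" "x \<otimes> z"]
    by (intro meet_le[simplified]) (auto simp: leq_inv_mult)
  then show "(x \<otimes> y) \<and>\<^sub>G (x \<otimes> z) \<preceq> x \<otimes> (y \<and>\<^sub>G z)"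
    using assms by (simp add: leq_inv_mult)
qed (use assms in auto)

lemma mult_join_distrib:
  assumes "x \<in> carrier G" "y \<in> carrier G" "z \<in> carrier G"
  shows "x \<otimes> (y \<or>\<^sub>G z) = (x \<otimes> y) \<or>\<^sub>G (x \<otimes> z)"
proof (rule le_antisym[simplified])
  show "(x \<otimes> y) \<or>\<^sub>G (x \<otimes> z) \<preceq> x \<otimes> (y \<or>\<^sub>G z)"
    using assms join_left[of y z] join_right[of y z]
    by (intro join_le[simplified] leq_mult_left) auto
  have "y \<or>\<^sub>G z \<preceq> inv x \<otimes> ((x \<otimes> y) \<or>\<^sub>G (x \<otimes> z))"
    using assms join_left[of "x \<otimes> y" "x \<otimes> z"] join_right[of "x \<otimes> y" "x \<otimes> z"]
    by (intro join_le[simplified]) (auto simp: leq_inv_mult)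
  then show "x \<otimes> (y \<or>\<^sub>G z) \<preceq> (x \<otimes> y) \<or>\<^sub>G (x \<otimes> z)"
    using assms by (simp add: leq_inv_mult)
qed (use assms in auto)

primrec lterm_eval :: "('x \<Rightarrow> 'a) \<Rightarrow> 'x lterm \<Rightarrow> 'a"
  where
    "lterm_eval g (Gen i) = g i"
  | "lterm_eval g Zer = \<one>"
  | "lterm_eval g (Neg t) = inv (lterm_eval g t)"
  | "lterm_eval g (Add s t) = lterm_eval g s \<otimes> lterm_eval g t"
  | "lterm_eval g (Meet s t) = lterm_eval g s \<and>\<^sub>G lterm_eval g t"
  | "lterm_eval g (Join s t) = lterm_eval g s \<or>\<^sub>G lterm_eval g t"

lemma lterm_eval_closed:
  "(\<And>i. i \<in> gens t \<Longrightarrow> g i \<in> carrier G) \<Longrightarrow> lterm_eval g t \<in> carrier G"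
  by (induction t) auto

lemma lterm_eval_cong:
  "(\<And>i. i \<in> gens t \<Longrightarrow> g i = h i) \<Longrightarrow> lterm_eval g t = lterm_eval h t"
  by (induction t) auto

lemma absorb:
  assumes "x \<in> carrier G" "y \<in> carrier G"
  shows "x \<and>\<^sub>G (x \<or>\<^sub>G y) = x" and "x \<or>\<^sub>G (x \<and>\<^sub>G y) = x"
proof -
  show "x \<and>\<^sub>G (x \<or>\<^sub>G y) = x"
    using assms join_left[of x y] meet_left[of x "x \<or>\<^sub>G y"]
    by (intro le_antisym[simplified] meet_le[simplified]) (auto simp: le_refl[simplified])
  show "x \<or>\<^sub>G (x \<and>\<^sub>G y) = x"
    using assms meet_left[of x y] join_left[of x "x \<and>\<^sub>G y"]
    by (intro le_antisym[simplified] join_le[simplified]) (auto simp: le_refl[simplified])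
qed

lemma lterm_eval_sound:
  assumes "s \<sim> t" and g: "\<And>i. g i \<in> carrier G"
  shows "lterm_eval g s = lterm_eval g t"
proof -
  have *: "lterm_eval g u \<in> carrier G" for u
    by (rule lterm_eval_closed) (rule g)
  show ?thesis
    using assms(1)
    by induction
      (auto simp: * m_assoc meet_assoc join_assoc absorb mult_meet_distrib mult_join_distrib
        intro: m_comm meet_comm join_comm)
qed

end

theorem FA_universal:
  assumes "comm_lgroup G" and g: "g \<in> {..<n} \<rightarrow> carrier G"
  shows "\<exists>!h. h \<in> lgroup_hom (FA n) G \<inter> extensional (carrier (FA n)) \<and>
    (\<forall>i<n. h (lclass n (Gen i)) = g i)"
proof -
  interpret comm_lgroup G by fact
  define g' where "g' i = (if i < n then g i else \<one>\<^bsub>G\<^esub>)" for i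
  define e where "e = lterm_eval g'"
  have e_closed: "e t \<in> carrier G" for t
    unfolding e_def g'_def using g by (intro lterm_eval_closed) auto
  have sound: "e s = e t" if "s \<sim> t" for s t
    unfolding e_def using that g by (intro lterm_eval_sound) (auto simp: g'_def)
  define h where "h = (\<lambda>X \<in> carrier (FA n). e (SOME t. t \<in> X))"
  have h: "h (lclass n t) = e t" if "t \<in> lterms n" for t
  proof -
    have "t \<in> lclass n t"
      using that unfolding mem_lclass_iff by (blast intro: lterm_eq.refl)
    then have "(SOME u. u \<in> lclass n t) \<in> lclass n t"
      by (rule someI)
    then have "t \<sim> (SOME u. u \<in> lclass n t)"
      unfolding mem_lclass_iff by (elim conjE)
    then have "e t = e (SOME u. u \<in> lclass n t)"
      by (rule sound)
    moreover have "lclass n t \<in> carrier (FA n)"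
      using that by (simp add: carrier_FA)
    ultimately show ?thesis
      by (simp add: h_def)
  qed
  show ?thesis
  proof (rule ex1I[of _ h])
    have "h \<in> lgroup_hom (FA n) G"
      unfolding lgroup_hom_def hom_def join_pres_def meet_pres_def
      using FA.lattice_axioms lattice_axioms
      by (auto simp: carrier_FA h mult_FA join_FA meet_FA e_closed) (simp_all add: e_def)
    then show "h \<in> lgroup_hom (FA n) G \<inter> extensional (carrier (FA n)) \<and>
        (\<forall>i<n. h (lclass n (Gen i)) = g i)"
      by (auto simp: h) (auto simp: h_def e_def g'_def)
  next
    fix k
    assume k: "k \<in> lgroup_hom (FA n) G \<inter> extensional (carrier (FA n)) \<and>
        (\<forall>i<n. k (lclass n (Gen i)) = g i)"
    then interpret k: group_hom "FA n" G k
      by unfold_locales (auto simp: lgroup_hom_def)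
    have kj: "k (x \<squnion>\<^bsub>po_of (FA n)\<^esub> y) = k x \<or>\<^sub>G k y" "k (x \<sqinter>\<^bsub>po_of (FA n)\<^esub> y) = k x \<and>\<^sub>G k y"
      if "x \<in> carrier (FA n)" "y \<in> carrier (FA n)" for x y
      using k that by (auto simp: lgroup_hom_def join_pres_def meet_pres_def)
    have c: "t \<in> lterms n \<Longrightarrow> lclass n t \<in> carrier (FA n)" for t
      by (simp add: carrier_FA)
    have "k (lclass n t) = e t" if "t \<in> lterms n" for t
      using that
    proof (induction t)
      case (Gen i)
      then show ?case
        using k by (simp add: e_def g'_def)
    next
      case Zer
      then show ?case
        using k.hom_one by (simp add: e_def one_FA)
    next
      case (Neg t)
      then have t: "t \<in> lterms n" by simp
      have "lclass n (Neg t) \<otimes>\<^bsub>FA n\<^esub> lclass n t = \<one>\<^bsub>FA n\<^esub>"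
        using t by (simp add: mult_FA one_FA lclass_eq_iff lterm_eq.Add_Neg)
      then have "lclass n (Neg t) = inv\<^bsub>FA n\<^esub> lclass n t"
        using t c by (intro FA.inv_equality[symmetric]) auto
      then show ?case
        using Neg.IH t c by (simp add: e_def)
    next
      case (Add s t)
      then show ?case
        using k.hom_mult[of "lclass n s" "lclass n t"] c by (simp add: e_def mult_FA)
    next
      case (Meet s t)
      then show ?case
        using kj(2)[of "lclass n s" "lclass n t"] c by (simp add: e_def meet_FA)
    next
      case (Join s t)
      then show ?case
        using kj(1)[of "lclass n s" "lclass n t"] c by (simp add: e_def join_FA)
    qed
    then show "k = h"
      using k h by (intro extensionalityI[of _ "carrier (FA n)"])
        (auto simp: carrier_FA h_def)
  qed
qed

theorem quot_comm_lgroup: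
  fixes G (structure)
  assumes "comm_lgroup G" and I: "l_ideal I G"
  shows "comm_lgroup (quot_lgroup G I)"
proof -
  interpret comm_lgroup G by fact
  interpret I: normal I G
    using I by (intro subgroup_imp_normal) (simp add: l_ideal_def)
  have IG [simp]: "i \<in> carrier G" if "i \<in> I" for i
    using that I.subset by auto
  have I_convex: "y \<in> I" if "x \<in> I" "z \<in> I" "y \<in> carrier G" "x \<preceq> y" "y \<preceq> z" for x y z
    using I that unfolding l_ideal_def by blast
  have I_join: "i \<or>\<^sub>G j \<in> I" if "i \<in> I" "j \<in> I" for i j
    using I that unfolding l_ideal_def by blast
  have carr: "carrier (quot_lgroup G I) = (\<lambda>x. I #> x) ` carrier G"
    by (simp add: quot_lgroup_def carrier_FactGroup)
  have mult: "(I #> x) \<otimes>\<^bsub>quot_lgroup G I\<^esub> (I #> y) = I #> (x \<otimes> y)"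
    if "x \<in> carrier G" "y \<in> carrier G" for x y
    using that by (simp add: quot_lgroup_def FactGroup_def I.rcos_sum)
  have one: "\<one>\<^bsub>quot_lgroup G I\<^esub> = I #> \<one>"
    by (simp add: quot_lgroup_def I.subset)
  have coset_eq: "I #> x = I #> y" if "x = i \<otimes> y" "i \<in> I" "y \<in> carrier G" for i x y
    using that coset_mult_assoc[OF I.subset, of i y] coset_join2[of i I] I.subgroup_axioms by simp
  have leq: "(I #> x) \<preceq>\<^bsub>quot_lgroup G I\<^esub> (I #> y) \<longleftrightarrow> (\<exists>i \<in> I. x \<preceq> i \<otimes> y)"
    if xy: "x \<in> carrier G" "y \<in> carrier G" for x y
  proof
    assume "(I #> x) \<preceq>\<^bsub>quot_lgroup G I\<^esub> (I #> y)"
    then obtain i j where ij: "i \<in> I" "j \<in> I" "i \<otimes> x \<preceq> j \<otimes> y"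
      by (auto simp: quot_lgroup_def r_coset_def)
    then have "x \<preceq> (inv i \<otimes> j) \<otimes> y"
      using xy leq_inv_mult(1)[of x "j \<otimes> y" i] by (simp add: m_assoc)
    then show "\<exists>i \<in> I. x \<preceq> i \<otimes> y"
      using ij by (intro bexI[of _ "inv i \<otimes> j"]) auto
  next
    assume "\<exists>i \<in> I. x \<preceq> i \<otimes> y"
    then obtain i where "i \<in> I" "x \<preceq> i \<otimes> y" by blast
    moreover have "x \<in> I #> x"
      using xy I.one_closed l_one[of x] unfolding r_coset_def by force
    moreover have "i \<otimes> y \<in> I #> y"
      using \<open>i \<in> I\<close> unfolding r_coset_def by blast
    ultimately show "(I #> x) \<preceq>\<^bsub>quot_lgroup G I\<^esub> (I #> y)"
      unfolding quot_lgroup_def po_group.simps by blast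
  qed
  have shift: "u \<preceq> i \<otimes> v \<Longrightarrow> i \<preceq> k \<Longrightarrow> u \<preceq> k \<otimes> v"
    if "u \<in> carrier G" "v \<in> carrier G" "i \<in> I" "k \<in> I" for u v i k
    using that leq_mult_left[of i k v] le_trans[simplified, of u "i \<otimes> v" "k \<otimes> v"]
    by (simp add: m_comm)
  show ?thesis
  proof (rule comm_lgroupI)
    show "comm_group (quot_lgroup G I)"
    proof (rule comm_groupI)
      show "\<exists>Y \<in> carrier (quot_lgroup G I). Y \<otimes>\<^bsub>quot_lgroup G I\<^esub> X = \<one>\<^bsub>quot_lgroup G I\<^esub>"
        if X: "X \<in> carrier (quot_lgroup G I)" for X
      proof -
        obtain x where "x \<in> carrier G" "X = I #> x"
          using X unfolding carr by blast
        then show ?thesis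
          by (intro bexI[of _ "I #> inv x"]) (simp_all add: carr mult one)
      qed
    qed (auto simp: carr mult one m_ac del: equalityI)
  next
    fix X assume "X \<in> carrier (quot_lgroup G I)"
    then obtain x where x: "x \<in> carrier G" "X = I #> x"
      unfolding carr by blast
    then show "X \<preceq>\<^bsub>quot_lgroup G I\<^esub> X"
      using le_refl[simplified, of x] leq[of x x] I.one_closed by (metis l_one)
  next
    fix X Y
    assume "X \<in> carrier (quot_lgroup G I)" "Y \<in> carrier (quot_lgroup G I)"
    then obtain x y where x: "x \<in> carrier G" "X = I #> x" and y: "y \<in> carrier G" "Y = I #> y"
      unfolding carr by blast
    show "X = Y" if le: "X \<preceq>\<^bsub>quot_lgroup G I\<^esub> Y" "Y \<preceq>\<^bsub>quot_lgroup G I\<^esub> X"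
    proof -
      obtain i j where ij: "i \<in> I" "j \<in> I" "x \<preceq> i \<otimes> y" "y \<preceq> j \<otimes> x"
        using le x y leq by auto
      have a: "inv y \<otimes> x \<preceq> i"
        using ij x y leq_inv_mult(2)[of i x y] by (simp add: m_comm[of y i])
      have "inv j \<otimes> y \<preceq> x"
        using ij x y by (simp add: leq_inv_mult)
      then have "inv y \<otimes> (inv j \<otimes> y) \<preceq> inv y \<otimes> x"
        using ij x y leq_mult_left[of "inv j \<otimes> y" x "inv y"] by simp
      moreover have "inv y \<otimes> (inv j \<otimes> y) = inv j"
        using ij y by (simp add: m_lcomm[of "inv y" "inv j" y])
      ultimately have "inv y \<otimes> x \<in> I"
        using I_convex[of "inv j" i "inv y \<otimes> x"] a ij x y by simp
      moreover have "x = (inv y \<otimes> x) \<otimes> y"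
        using x y by (metis inv_closed m_assoc m_comm r_inv r_one l_inv)
      ultimately show ?thesis
        using coset_eq[of x "inv y \<otimes> x" y] x y by simp
    qed
    show "\<exists>s. least (po_of (quot_lgroup G I)) s (Upper (po_of (quot_lgroup G I)) {X, Y})"
    proof -
      have "\<exists>k \<in> I. x \<or>\<^sub>G y \<preceq> k \<otimes> z"
        if "i \<in> I" "j \<in> I" "x \<preceq> i \<otimes> z" "y \<preceq> j \<otimes> z" "z \<in> carrier G" for i j z
      proof (rule bexI[of _ "i \<or>\<^sub>G j"])
        have "x \<preceq> (i \<or>\<^sub>G j) \<otimes> z" "y \<preceq> (i \<or>\<^sub>G j) \<otimes> z"
          using that x y join_left[of i j] join_right[of i j] I_join
            shift[of x z i "i \<or>\<^sub>G j"] shift[of y z j "i \<or>\<^sub>G j"] by simp_all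
        then show "x \<or>\<^sub>G y \<preceq> (i \<or>\<^sub>G j) \<otimes> z"
          using that x y by (simp add: join_le[simplified])
      qed (use that I_join in auto)
      then have "\<forall>Z \<in> carrier (quot_lgroup G I).
          X \<preceq>\<^bsub>quot_lgroup G I\<^esub> Z \<and> Y \<preceq>\<^bsub>quot_lgroup G I\<^esub> Z \<longrightarrow> I #> (x \<or>\<^sub>G y) \<preceq>\<^bsub>quot_lgroup G I\<^esub> Z"
        using x y by (auto simp: carr leq)
      moreover have "X \<preceq>\<^bsub>quot_lgroup G I\<^esub> I #> (x \<or>\<^sub>G y)" "Y \<preceq>\<^bsub>quot_lgroup G I\<^esub> I #> (x \<or>\<^sub>G y)"
        using x y join_left[of x y] join_right[of x y]
        by (auto simp: leq intro!: bexI[of _ \<one>])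
      moreover have "I #> (x \<or>\<^sub>G y) \<in> carrier (quot_lgroup G I)" "X \<in> carrier (quot_lgroup G I)"
        "Y \<in> carrier (quot_lgroup G I)"
        using x y by (auto simp: carr)
      ultimately show ?thesis
        unfolding least_def Upper_def po_of_simps by (intro exI[of _ "I #> (x \<or>\<^sub>G y)"]) blast
    qed
    show "\<exists>s. greatest (po_of (quot_lgroup G I)) s (Lower (po_of (quot_lgroup G I)) {X, Y})"
    proof -
      have "\<exists>k \<in> I. z \<preceq> k \<otimes> (x \<and>\<^sub>G y)"
        if "i \<in> I" "j \<in> I" "z \<preceq> i \<otimes> x" "z \<preceq> j \<otimes> y" "z \<in> carrier G" for i j z
      proof (rule bexI[of _ "i \<or>\<^sub>G j"])
        have "z \<preceq> (i \<or>\<^sub>G j) \<otimes> x" "z \<preceq> (i \<or>\<^sub>G j) \<otimes> y"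
          using that x y join_left[of i j] join_right[of i j] I_join
            shift[of z x i "i \<or>\<^sub>G j"] shift[of z y j "i \<or>\<^sub>G j"] by simp_all
        then show "z \<preceq> (i \<or>\<^sub>G j) \<otimes> (x \<and>\<^sub>G y)"
          using that x y by (simp add: mult_meet_distrib meet_le[simplified])
      qed (use that I_join in auto)
      then have "\<forall>Z \<in> carrier (quot_lgroup G I).
          Z \<preceq>\<^bsub>quot_lgroup G I\<^esub> X \<and> Z \<preceq>\<^bsub>quot_lgroup G I\<^esub> Y \<longrightarrow> Z \<preceq>\<^bsub>quot_lgroup G I\<^esub> I #> (x \<and>\<^sub>G y)"
        using x y by (auto simp: carr leq)
      moreover have "I #> (x \<and>\<^sub>G y) \<preceq>\<^bsub>quot_lgroup G I\<^esub> X" "I #> (x \<and>\<^sub>G y) \<preceq>\<^bsub>quot_lgroup G I\<^esub> Y"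
        using x y meet_left[of x y] meet_right[of x y]
        by (auto simp: leq intro!: bexI[of _ \<one>])
      moreover have "I #> (x \<and>\<^sub>G y) \<in> carrier (quot_lgroup G I)" "X \<in> carrier (quot_lgroup G I)"
        "Y \<in> carrier (quot_lgroup G I)"
        using x y by (auto simp: carr)
      ultimately show ?thesis
        unfolding greatest_def Lower_def po_of_simps by (intro exI[of _ "I #> (x \<and>\<^sub>G y)"]) blast
    qed
  next
    fix X Y Z
    assume "X \<in> carrier (quot_lgroup G I)" "Y \<in> carrier (quot_lgroup G I)"
      "Z \<in> carrier (quot_lgroup G I)"
    then obtain x y z where x: "x \<in> carrier G" "X = I #> x" and y: "y \<in> carrier G" "Y = I #> y"
      and z: "z \<in> carrier G" "Z = I #> z"
      unfolding carr by blast
    show "X \<preceq>\<^bsub>quot_lgroup G I\<^esub> Z" if le: "X \<preceq>\<^bsub>quot_lgroup G I\<^esub> Y" "Y \<preceq>\<^bsub>quot_lgroup G I\<^esub> Z"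
    proof -
      obtain i j where ij: "i \<in> I" "j \<in> I" "x \<preceq> i \<otimes> y" "y \<preceq> j \<otimes> z"
        using le x y z leq by auto
      then have "x \<preceq> (i \<otimes> j) \<otimes> z"
        using x y z leq_mult_left[of y "j \<otimes> z" i] le_trans[simplified, of x "i \<otimes> y" "i \<otimes> (j \<otimes> z)"]
        by (simp add: m_assoc)
      then show ?thesis
        using ij x z leq by auto
    qed
    show "Z \<otimes>\<^bsub>quot_lgroup G I\<^esub> X \<preceq>\<^bsub>quot_lgroup G I\<^esub> Z \<otimes>\<^bsub>quot_lgroup G I\<^esub> Y" if le: "X \<preceq>\<^bsub>quot_lgroup G I\<^esub> Y"
    proof -
      obtain i where i: "i \<in> I" "x \<preceq> i \<otimes> y"
        using le x y leq by auto
      then have "z \<otimes> x \<preceq> i \<otimes> (z \<otimes> y)"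
        using x y z leq_mult_left[of x "i \<otimes> y" z] by (simp add: m_lcomm)
      then show ?thesis
        using i x y z by (auto simp: mult leq)
    qed
  qed
qed

end

theory Submission
  imports Defs "HOL-Library.Lattice_Algebras" "HOL-Library.Function_Algebras"
begin

text \<open>
  Write \<open>A = FA(n)/I\<close>. If \<open>b\<close> is a linear form, then \<open>b\<^sup>+\<close> and \<open>b\<^sup>-\<close> are disjoint, so an inequality
  holds in \<open>A\<close> as soon as it holds after imposing \<open>b \<le> 0\<close> and after imposing \<open>b \<ge> 0\<close>.
  Finitely many such splittings turn all terms under consideration, including the generators of
  \<open>I\<close>, into linear forms. In each case Farkas' lemma shows that a linear form is entailed by
  the imposed linear inequalities iff it satisfies them at all integer points of the dual cone, and
  by Dickson's lemma finitely many points suffice. Hence the positivity of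
  \<open>a\<^sub>1\<xi>\<^sub>1 + \<dots> + a\<^sub>k\<xi>\<^sub>k\<close> amounts to finitely many homogeneous
  linear inequalities in \<open>\<xi>\<close>, and Gordan's lemma applies.
\<close>

section \<open>Finitely generated integer cones\<close>

text \<open>The obstacle is uniformity in \<xi>: infinitely many combinations have to be tested by
  one finite set of points. So the splittings are made for the elements a_i and the relations
  separately, never for their combination. Once these are linear under some sign conditions, every
  integer combination is linear under the same conditions, and both conditions and test points are
  fixed before \<xi> is chosen. Finite generation of the ideal enters here too: the relations are
  linearized along with the a_i, and finitely many terms need finitely many splittings.

  Over the integers, elimination as in Farkas' lemma expresses only a positive multiple of the
  wanted form. The multiple is removed inside the lattice-ordered group, where k x \<le> 0 with k >
  0 forces x \<le> 0; this is again a splitting argument, so it also works modulo the ideal.\<close>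

lemma dickson:
  fixes f :: "'i \<Rightarrow> 'a \<Rightarrow> nat"
  assumes "finite I"
  shows "\<exists>B \<subseteq> S. finite B \<and> (\<forall>s \<in> S. \<exists>b \<in> B. \<forall>i \<in> I. f i b \<le> f i s)"
  using assms
proof (induction I arbitrary: S rule: finite_induct)
  case empty
  show ?case
  proof (cases "S = {}")
    case False
    then obtain s where "s \<in> S" by blast
    then show ?thesis by (intro exI[of _ "{s}"]) auto
  qed auto
next
  case (insert k I)
  obtain B where B: "B \<subseteq> S" "finite B" "\<forall>s \<in> S. \<exists>b \<in> B. \<forall>i \<in> I. f i b \<le> f i s"
    using insert.IH[of S] by blast
  \<comment> \<open>\<open>B\<close> ignores the coordinate \<open>k\<close>, so it only serves
    elements whose \<open>k\<close>-value is large. For each small value \<open>j\<close> the slice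
    with constant \<open>k\<close>-coordinate gets its own finite set, which is why \<open>S\<close>
    is arbitrary in the induction.\<close>
  have "\<forall>j. \<exists>C \<subseteq> {s \<in> S. f k s = j}. finite C \<and>
      (\<forall>s \<in> {s \<in> S. f k s = j}. \<exists>b \<in> C. \<forall>i \<in> I. f i b \<le> f i s)"
    by (intro allI insert.IH)
  from choice[OF this] obtain C where *: "\<forall>j. C j \<subseteq> {s \<in> S. f k s = j} \<and> finite (C j) \<and>
      (\<forall>s \<in> {s \<in> S. f k s = j}. \<exists>b \<in> C j. \<forall>i \<in> I. f i b \<le> f i s)" ..
  have C: "C j \<subseteq> {s \<in> S. f k s = j}" "finite (C j)"
    "\<forall>s \<in> {s \<in> S. f k s = j}. \<exists>b \<in> C j. \<forall>i \<in> I. f i b \<le> f i s" for j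
    using spec[OF *, of j] by simp_all
  \<comment> \<open>\<open>M\<close> serves only as an upper bound for \<open>f k\<close> on
    \<open>B\<close>; a sum also makes sense for empty \<open>B\<close>.\<close>
  define M where "M = (\<Sum>b\<in>B. f k b)"
  have M: "f k b \<le> M" if "b \<in> B" for b
    unfolding M_def using that B(2) by (simp add: member_le_sum)
  show ?case
  proof (intro exI[of _ "B \<union> (\<Union>j<M. C j)"] conjI ballI)
    show "B \<union> (\<Union>j<M. C j) \<subseteq> S" "finite (B \<union> (\<Union>j<M. C j))"
      using B(1,2) C(1,2) by blast+
    fix s assume s: "s \<in> S"
    show "\<exists>b \<in> B \<union> (\<Union>j<M. C j). \<forall>i \<in> insert k I. f i b \<le> f i s"
    proof (cases "M \<le> f k s")
      case True
      obtain b where b: "b \<in> B" "\<forall>i \<in> I. f i b \<le> f i s"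
        using B(3) s by blast
      with M[of b] True show ?thesis
        by (intro bexI[of _ b]) auto
    next
      case False
      obtain b where "b \<in> C (f k s)" "\<forall>i \<in> I. f i b \<le> f i s"
        using C(3)[of "f k s"] s by blast
      then show ?thesis
        using False C(1)[of "f k s"] by (intro bexI[of _ b]) auto
    qed
  qed
qed

inductive_set sums_of :: "'v::monoid_add set \<Rightarrow> 'v set" for B
  where
    zero: "0 \<in> sums_of B"
  | add: "b \<in> B \<Longrightarrow> y \<in> sums_of B \<Longrightarrow> b + y \<in> sums_of B"

text \<open>Dickson's lemma for the value vectors of nonzero cone elements gives \<open>B\<close>:
  every nonzero \<open>x\<close> in the cone has some \<open>b\<close> in \<open>B\<close> for which
  \<open>x - b\<close> is still in the cone. By \<open>pointed\<close>, \<open>b\<close> has a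
  nonzero value, so the sum of all values drops strictly and the descent ends at 0.\<close>

lemma gordan:
  fixes F :: "('v::ab_group_add \<Rightarrow> int) set" and W :: "'v set"
  assumes "finite F"
    and diff: "\<And>f x y. f \<in> F \<Longrightarrow> f (x - y) = f x - f y"
    and W: "\<And>x y. x \<in> W \<Longrightarrow> y \<in> W \<Longrightarrow> x - y \<in> W"
    and pointed: "\<And>x. x \<in> W \<Longrightarrow> (\<And>f. f \<in> F \<Longrightarrow> f x = 0) \<Longrightarrow> x = 0"
  shows "\<exists>B. finite B \<and> B \<subseteq> {x \<in> W. \<forall>f \<in> F. 0 \<le> f x} \<and>
    {x \<in> W. \<forall>f \<in> F. 0 \<le> f x} \<subseteq> sums_of B"
proof -
  \<comment> \<open>Zero is excluded because it would dominate nothing useful: subtracting it makes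
    no progress.\<close>
  define S where "S = {x \<in> W. (\<forall>f \<in> F. 0 \<le> f x) \<and> x \<noteq> 0}"
  obtain B where B: "B \<subseteq> S" "finite B" "\<forall>s \<in> S. \<exists>b \<in> B. \<forall>f \<in> F. nat (f b) \<le> nat (f s)"
    using dickson[OF assms(1), of S "\<lambda>f x. nat (f x)"] by blast
  have "x \<in> sums_of B" if "x \<in> W" "\<forall>f \<in> F. 0 \<le> f x" for x
    using that
    proof (induction "nat (\<Sum>f\<in>F. f x)" arbitrary: x rule: less_induct)
      case less
      show ?case
      proof (cases "x = 0")
        case True
        then show ?thesis by (simp add: sums_of.zero)
      next
        case False
        then have "x \<in> S" using less.prems by (simp add: S_def)
        then obtain b where b: "b \<in> B" "\<forall>f \<in> F. nat (f b) \<le> nat (f x)"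
          using B(3) by blast
        then have bS: "b \<in> W" "\<forall>f \<in> F. 0 \<le> f b" "b \<noteq> 0"
          using B(1) by (auto simp: S_def)
        have y: "x - b \<in> W" "\<forall>f \<in> F. 0 \<le> f (x - b)"
          using b bS less.prems W by (auto simp: diff nat_le_eq_zle)
        obtain f where "f \<in> F" "f b \<noteq> 0"
          using pointed[of b] bS by blast
        then have "0 < (\<Sum>f\<in>F. f b)"
          using bS(2) assms(1) by (intro sum_pos2[of _ f]) force+
        moreover have "(\<Sum>f\<in>F. f (x - b)) = (\<Sum>f\<in>F. f x) - (\<Sum>f\<in>F. f b)"
          by (simp add: diff sum_subtractf)
        moreover have "0 \<le> (\<Sum>f\<in>F. f (x - b))"
          using y by (intro sum_nonneg) auto
        ultimately have "nat (\<Sum>f\<in>F. f (x - b)) < nat (\<Sum>f\<in>F. f x)"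
          by linarith
        then have "x - b \<in> sums_of B"
          using less.hyps y by blast
        then have "b + (x - b) \<in> sums_of B"
          using b(1) by (rule sums_of.add[rotated])
        then show ?thesis by simp
      qed
    qed
  moreover have "B \<subseteq> {x \<in> W. \<forall>f \<in> F. 0 \<le> f x}"
    using B(1) by (auto simp: S_def)
  ultimately show ?thesis
    using B(2) by blast
qed

section \<open>Integer linear forms, Farkas' lemma and generators of the dual cone\<close>

definition pairing :: "nat \<Rightarrow> (nat \<Rightarrow> int) \<Rightarrow> (nat \<Rightarrow> int) \<Rightarrow> int"
  where "pairing n c x = (\<Sum>i<n. c i * x i)"

lemma pairing_simps [simp]:
  "pairing n 0 x = 0" "pairing n c 0 = 0"
  "pairing n (c + d) x = pairing n c x + pairing n d x"
  "pairing n (- c) x = - pairing n c x"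
  "pairing n (\<lambda>i. k * c i) x = k * pairing n c x"
  "pairing n c (x + y) = pairing n c x + pairing n c y"
  "pairing n c (x - y) = pairing n c x - pairing n c y"
  "pairing n c (\<lambda>i. k * x i) = k * pairing n c x"
  by (simp_all add: pairing_def algebra_simps sum.distrib sum_subtractf sum_negf sum_distrib_left)

lemma pairing_cong:
  "(\<And>i. i < n \<Longrightarrow> x i = y i) \<Longrightarrow> pairing n c x = pairing n c y"
  by (simp add: pairing_def)

lemma pairing_unit: "j < n \<Longrightarrow> pairing n c (\<lambda>i. if i = j then 1 else 0) = c j"
  by (simp add: pairing_def if_distrib[of "\<lambda>x. _ * x"] cong: if_cong)

text \<open>
  The induction is Bartl's: if the last inequality \<open>m\<close> is needed, some \<open>y\<close> satisfies the
  others but not \<open>u\<close>, hence not \<open>m\<close>; projecting along \<open>y\<close> onto the kernel of \<open>m\<close>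
  eliminates \<open>m\<close>.
\<close>

lemma farkas:
  assumes "finite L" "L \<subseteq> K"
    and null: "\<And>c. (\<And>i. i < n \<Longrightarrow> c i = 0) \<Longrightarrow> c \<in> K"
    and add: "\<And>c d. c \<in> K \<Longrightarrow> d \<in> K \<Longrightarrow> c + d \<in> K"
    and scale: "\<And>c (k::int). c \<in> K \<Longrightarrow> 0 \<le> k \<Longrightarrow> (\<lambda>i. k * c i) \<in> K"
    and divide: "\<And>c (k::int). (\<lambda>i. k * c i) \<in> K \<Longrightarrow> 0 < k \<Longrightarrow> c \<in> K"
    and u: "\<And>x. (\<And>l. l \<in> L \<Longrightarrow> pairing n l x \<le> 0) \<Longrightarrow> pairing n u x \<le> 0"
  shows "u \<in> K"
proof -
  have "u \<in> K"
    if "set ls \<subseteq> K" "\<And>x. (\<And>l. l \<in> set ls \<Longrightarrow> pairing n l x \<le> 0) \<Longrightarrow> pairing n u x \<le> 0"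
    for ls u
    using that
  proof (induction "length ls" arbitrary: ls u)
    case 0
    have "u i = 0" if "i < n" for i
    proof -
      define e :: "nat \<Rightarrow> int" where "e = (\<lambda>j. if j = i then 1 else 0)"
      have "pairing n u e = u i"
        using that by (simp add: e_def pairing_unit)
      moreover have "pairing n u (0 - e) = - pairing n u e"
        unfolding pairing_simps by simp
      moreover have "pairing n u e \<le> 0" "pairing n u (0 - e) \<le> 0"
        using 0(1) by (auto intro: 0(3))
      ultimately show ?thesis by linarith
    qed
    then show ?case using null by blast
  next
    case (Suc k ls)
    then obtain m ls' where ls: "ls = m # ls'" by (cases ls) auto
    show ?case
    proof (cases "\<forall>x. (\<forall>l \<in> set ls'. pairing n l x \<le> 0) \<longrightarrow> pairing n u x \<le> 0")
      case True
      then show ?thesis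
        using Suc.hyps(1)[of ls' u] Suc.hyps(2) Suc.prems(1) ls by auto
    next
      case False
      then obtain y where y: "\<And>l. l \<in> set ls' \<Longrightarrow> pairing n l y \<le> 0" "0 < pairing n u y"
        by force
      define c where "c = pairing n m y"
      have c: "0 < c"
        using Suc.prems(2)[of y] y ls by (force simp: c_def)
      \<comment> \<open>The projection along \<open>y\<close> is multiplied by \<open>c\<close> to
        stay integral, and is written on forms, as the adjoint of the map on points. For
        \<open>l\<close> in \<open>ls'\<close> the coefficient of \<open>m\<close> is nonnegative,
        so \<open>proj l\<close> stays in \<open>K\<close>; for \<open>u\<close> it is negative, and
        the induction hypothesis is needed.\<close>
      define proj where "proj v = (\<lambda>i. c * v i) + (\<lambda>i. (- pairing n v y) * m i)" for v
      have proj: "pairing n (proj v) x = pairing n v ((\<lambda>i. c * x i) - (\<lambda>i. pairing n m x * y i))"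
        for v x
        unfolding proj_def pairing_simps by simp
      have mK: "m \<in> K" using Suc.prems(1) ls by simp
      have "proj u \<in> K"
      proof (rule Suc.hyps(1)[of "map proj ls'"])
        show "k = length (map proj ls')" using Suc.hyps(2) ls by simp
        have "proj l \<in> K" if "l \<in> set ls'" for l
          unfolding proj_def
          using that Suc.prems(1) ls mK c y(1)[OF that] by (intro add[OF scale scale]) auto
        then show "set (map proj ls') \<subseteq> K" by auto
        fix x assume x: "\<And>l. l \<in> set (map proj ls') \<Longrightarrow> pairing n l x \<le> 0"
        show "pairing n (proj u) x \<le> 0"
          unfolding proj
        proof (rule Suc.prems(2))
          fix l assume "l \<in> set ls"
          then consider "l = m" | "l \<in> set ls'" using ls by auto
          then show "pairing n l ((\<lambda>i. c * x i) - (\<lambda>i. pairing n m x * y i)) \<le> 0"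
          proof cases
            case 1
            then show ?thesis by (simp add: c_def)
          next
            case 2
            then show ?thesis using x[of "proj l"] proj by simp
          qed
        qed
      qed
      then have "proj u + (\<lambda>i. pairing n u y * m i) \<in> K"
        using mK y(2) by (intro add[OF _ scale]) simp_all
      also have "proj u + (\<lambda>i. pairing n u y * m i) = (\<lambda>i. c * u i)"
        by (simp add: proj_def fun_eq_iff)
      finally show ?thesis using c by (rule divide)
    qed
  qed
  moreover obtain ls where "set ls = L" using assms(1) finite_list by blast
  ultimately show ?thesis using assms(2) u by blast
qed

text \<open>The cone of points satisfying \<open>L\<close> may contain lines, so
  \<open>gordan\<close> does not apply to it directly. Each orthant cuts out a pointed piece; the
  generators of all these pieces together form \<open>V\<close>, and a form that is nonpositive on
  generators is nonpositive on their sums.\<close>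

lemma cone_finite_test:
  assumes "finite L"
  shows "\<exists>V. finite V \<and> (\<forall>z \<in> V. \<forall>l \<in> L. pairing n l z \<le> 0) \<and>
    (\<forall>u x. (\<forall>z \<in> V. pairing n u z \<le> 0) \<longrightarrow> (\<forall>l \<in> L. pairing n l x \<le> 0) \<longrightarrow> pairing n u x \<le> 0)"
proof -
  \<comment> \<open>Coordinates from \<open>n\<close> on are invisible to all the functionals;
    fixing them to 0 is what makes the pieces pointed.\<close>
  define W where "W = {x :: nat \<Rightarrow> int. \<forall>i\<ge>n. x i = 0}"
  define orth :: "nat set \<Rightarrow> nat \<Rightarrow> (nat \<Rightarrow> int) \<Rightarrow> int"
    where "orth Q i x = (if i \<in> Q then x i else - x i)" for Q i x
  define F where "F Q = (\<lambda>l x. - pairing n l x) ` L \<union> orth Q ` {..<n}" for Q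
  have "\<exists>B. finite B \<and> B \<subseteq> {x \<in> W. \<forall>f \<in> F Q. 0 \<le> f x} \<and>
    {x \<in> W. \<forall>f \<in> F Q. 0 \<le> f x} \<subseteq> sums_of B" for Q
  proof (rule gordan[of "F Q" W])
    show "finite (F Q)" using assms by (simp add: F_def)
    show "f (x - y) = f x - f y" if "f \<in> F Q" for f x y
      using that by (auto simp: F_def orth_def)
    show "x - y \<in> W" if "x \<in> W" "y \<in> W" for x y
      using that by (auto simp: W_def)
    show "x = 0" if x: "x \<in> W" "\<And>f. f \<in> F Q \<Longrightarrow> f x = 0" for x
    proof
      fix i
      show "x i = 0 i"
        using x(1) x(2)[of "orth Q i"]
        by (cases "i < n") (auto simp: W_def F_def orth_def split: if_splits)
    qed
  qed
  then have "\<forall>Q. \<exists>B. finite B \<and> B \<subseteq> {x \<in> W. \<forall>f \<in> F Q. 0 \<le> f x} \<and>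
    {x \<in> W. \<forall>f \<in> F Q. 0 \<le> f x} \<subseteq> sums_of B"
    by blast
  from choice[OF this] obtain B where *: "\<forall>Q. finite (B Q) \<and>
    B Q \<subseteq> {x \<in> W. \<forall>f \<in> F Q. 0 \<le> f x} \<and> {x \<in> W. \<forall>f \<in> F Q. 0 \<le> f x} \<subseteq> sums_of (B Q)" ..
  have B: "finite (B Q)" "B Q \<subseteq> {x \<in> W. \<forall>f \<in> F Q. 0 \<le> f x}"
    "{x \<in> W. \<forall>f \<in> F Q. 0 \<le> f x} \<subseteq> sums_of (B Q)" for Q
    using spec[OF *, of Q] by simp_all
  show ?thesis
  proof (intro exI[of _ "\<Union>Q \<in> Pow {..<n}. B Q"] conjI ballI allI impI)
    show "finite (\<Union>Q \<in> Pow {..<n}. B Q)" using B(1) by auto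
    show "pairing n l z \<le> 0" if "z \<in> (\<Union>Q \<in> Pow {..<n}. B Q)" "l \<in> L" for z l
      using that B(2) by (force simp: F_def)
    fix u x
    assume u: "\<forall>z \<in> (\<Union>Q \<in> Pow {..<n}. B Q). pairing n u z \<le> 0"
      and x: "\<forall>l \<in> L. pairing n l x \<le> 0"
    define x' where "x' i = (if i < n then x i else 0)" for i
    define Q where "Q = {i. i < n \<and> 0 \<le> x i}"
    have x': "pairing n c x' = pairing n c x" for c
      by (rule pairing_cong) (simp add: x'_def)
    have "x' \<in> W" by (simp add: W_def x'_def)
    moreover have "\<forall>f \<in> F Q. 0 \<le> f x'"
      using x by (auto simp: F_def orth_def x' Q_def) (auto simp: x'_def)
    ultimately have "x' \<in> sums_of (B Q)"
      using B(3)[of Q] by blast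
    moreover have *: "pairing n u b \<le> 0" if "b \<in> B Q" for b
      using that by (intro u[rule_format]) (auto simp: Q_def)
    have "pairing n u y \<le> 0" if "y \<in> sums_of (B Q)" for y
      using that
    proof (induction rule: sums_of.induct)
      case zero
      show ?case by (simp only: pairing_simps)
    next
      case (add b y)
      then show ?case
        using *[OF add.hyps(1)] unfolding pairing_simps by linarith
    qed
    ultimately have "pairing n u x' \<le> 0" by blast
    then show "pairing n u x \<le> 0" by (simp add: x')
  qed
qed

section \<open>Lattice-ordered abelian groups modulo inequalities\<close>

primrec nmul :: "nat \<Rightarrow> 'a::monoid_add \<Rightarrow> 'a"
  where
    "nmul 0 x = 0"
  | "nmul (Suc k) x = x + nmul k x"

definition zmul :: "int \<Rightarrow> 'a::ab_group_add \<Rightarrow> 'a"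
  where "zmul k x = (if 0 \<le> k then nmul (nat k) x else - nmul (nat (- k)) x)"

lemma zmul_add_one: "zmul (k + 1) x = x + zmul k x"
proof -
  \<comment> \<open>The value -1 stands apart because there \<open>k\<close> and
    \<open>k + 1\<close> fall under different branches of \<open>zmul\<close>.\<close>
  consider "0 \<le> k" | "k = -1" | "k < -1" by linarith
  then show ?thesis
  proof cases
    case 1
    then show ?thesis by (simp add: zmul_def nat_add_distrib)
  next
    case 3
    then have "nat (- k) = Suc (nat (- (k + 1)))" by simp
    with 3 show ?thesis by (simp add: zmul_def)
  qed (simp add: zmul_def)
qed

lemma zmul_simps: "zmul 0 x = 0" "zmul 1 x = x"
  using zmul_add_one[of 0 x] by (simp_all add: zmul_def)

lemma zmul_diff_one: "zmul (k - 1) x = zmul k x - x"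
  using zmul_add_one[of "k - 1" x] by simp

lemma zmul_add_left: "zmul (k + l) x = zmul k x + zmul l x"
proof (induction k rule: int_induct[where k = 0])
  case (step1 i)
  moreover have "i + 1 + l = (i + l) + 1" by simp
  ultimately show ?case
    by (simp only: zmul_add_one add.assoc[of x])
next
  case (step2 i)
  moreover have "i - 1 + l = (i + l) - 1" by simp
  ultimately show ?case
    by (simp only: zmul_diff_one add_diff_eq diff_add_eq)
qed (simp add: zmul_simps)

lemma zmul_add_right: "zmul k (x + y) = zmul k x + zmul k y"
  by (induction k rule: int_induct[where k = 0])
    (simp_all add: zmul_simps zmul_add_one zmul_diff_one algebra_simps)

lemma zmul_mult: "zmul (k * l) x = zmul k (zmul l x)"
proof (induction k rule: int_induct[where k = 0])
  case (step1 i)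
  then show ?case by (simp add: zmul_add_one distrib_right zmul_add_left zmul_simps)
next
  case (step2 i)
  then show ?case
    using zmul_add_left[of "i * l - l" l x] by (simp add: zmul_diff_one left_diff_distrib)
qed (simp add: zmul_simps)

interpretation zmul: module "zmul :: int \<Rightarrow> 'a::ab_group_add \<Rightarrow> 'a"
  by unfold_locales (simp_all add: zmul_add_left zmul_add_right zmul_mult zmul_simps)

text \<open>By distributivity the right-hand side is the infimum of \<open>a + b\<close>,
  \<open>a + q\<close>, \<open>q + b\<close> and \<open>q + q\<close>, and each of these lies above
  the left-hand side. This carries disjointness from elements to their multiples.\<close>

lemma inf_add_le:
  fixes a b q :: "'a::lattice_ab_group_add"
  assumes "0 \<le> a" "0 \<le> b" "0 \<le> q"
  shows "inf (a + b) q \<le> inf a q + inf b q"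
proof -
  have *: "inf (a + b) q \<le> q + y" if "0 \<le> y" for y
    using that by (simp add: le_infI2 add_increasing2)
  have "inf (a + b) q \<le> a + q"
    using *[OF assms(1)] by (simp add: add.commute)
  then show ?thesis
    using *[OF assms(2)] *[OF assms(3)]
    by (simp add: add_inf_distrib_left add_inf_distrib_right)
qed

lemma zmul_nonneg:
  fixes x :: "'a::ordered_ab_group_add"
  assumes "0 \<le> k" "0 \<le> x"
  shows "0 \<le> zmul k x"
  using assms(1) by (induction k rule: int_ge_induct) (simp_all add: zmul_add_one assms)

lemma inf_zmul_eq_0:
  fixes p q :: "'a::lattice_ab_group_add"
  assumes "inf p q = 0" "0 \<le> k"
  shows "inf (zmul k p) q = 0"
proof -
  have pq: "0 \<le> p" "0 \<le> q"
    using inf_le1[of p q] inf_le2[of p q] assms(1) by simp_all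
  show ?thesis
    using assms(2)
  proof (induction k rule: int_ge_induct)
    case base
    then show ?case using pq by (simp add: inf.absorb1)
  next
    case (step i)
    have "inf (p + zmul i p) q \<le> inf p q + inf (zmul i p) q"
      by (intro inf_add_le zmul_nonneg step pq)
    then have "inf (p + zmul i p) q \<le> 0"
      using step assms by simp
    moreover have "0 \<le> inf (p + zmul i p) q"
      using pq zmul_nonneg[of i p] step by simp
    ultimately show ?case
      by (simp add: zmul_add_one)
  qed
qed

text \<open>Since \<open>pprt b\<close> is \<open>b\<close> translated by \<open>pprt (- b)\<close>,
  the infimum is \<open>inf b 0\<close> under the same translation, and \<open>inf b 0\<close> is
  the negative of \<open>pprt (- b)\<close>.\<close>

lemma inf_pprt_uminus: "inf (pprt b) (pprt (- b)) = (0 :: 'a::lattice_ab_group_add)"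
proof -
  have "pprt b = b + pprt (- b)"
    by (metis prts pprt_neg diff_conv_add_uminus eq_diff_eq)
  then have "inf (pprt b) (pprt (- b)) = inf (b + pprt (- b)) (0 + pprt (- b))"
    by simp
  also have "\<dots> = nprt b + pprt (- b)"
    by (simp only: nprt_def flip: add_inf_distrib_right)
  finally show ?thesis
    by (simp add: pprt_neg)
qed

text \<open>
  \<open>entailed S x\<close> says that \<open>x \<le> 0\<close> holds modulo the \<open>\<ell>\<close>-ideal generated by the positive
  parts of the elements of \<open>S\<close>, i.e. after imposing \<open>s \<le> 0\<close> for all \<open>s \<in> S\<close>.
\<close>

inductive entailed :: "'a::lattice_ab_group_add set \<Rightarrow> 'a \<Rightarrow> bool" for S
  where
    base: "s \<in> S \<Longrightarrow> entailed S (pprt s)"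
  | zero: "entailed S 0"
  | add: "entailed S x \<Longrightarrow> entailed S y \<Longrightarrow> entailed S (x + y)"
  | le: "entailed S y \<Longrightarrow> x \<le> y \<Longrightarrow> entailed S x"

lemma le_pprt: "x \<le> pprt (x :: 'a::lattice_ab_group_add)"
  unfolding pprt_def by (rule sup_ge1)

lemma entailed_mem: "s \<in> S \<Longrightarrow> entailed S s"
  by (rule entailed.le[OF entailed.base le_pprt])

lemma entailed_mono: "entailed S x \<Longrightarrow> S \<subseteq> T \<Longrightarrow> entailed T x"
  by (induction rule: entailed.induct) (auto intro: entailed.intros)

text \<open>This is the reason for having \<open>pprt s\<close> instead of \<open>s\<close> in the
  rule \<open>base\<close>: the generators equal their own positive parts. It makes the entailed
  elements closed under suprema.\<close>

lemma entailed_pprt: "entailed S x \<Longrightarrow> entailed S (pprt x)"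
proof (induction rule: entailed.induct)
  case (base s)
  then show ?case by (simp add: pprt_def entailed.base[unfolded pprt_def])
next
  case zero
  then show ?case by (simp add: entailed.zero)
next
  case (add x y)
  have "pprt (x + y) \<le> pprt x + pprt y"
    by (simp add: pprt_def add_mono add_increasing)
  with add.IH show ?case by (blast intro: entailed.intros)
next
  case (le y x)
  then show ?case by (blast intro: entailed.le pprt_mono)
qed

lemma entailed_sup: "entailed S x \<Longrightarrow> entailed S y \<Longrightarrow> entailed S (sup x y)"
  by (rule entailed.le[of S "pprt x + pprt y"])
    (simp_all add: entailed.add entailed_pprt le_pprt add_increasing add_increasing2)

lemma entailed_zmul:
  assumes "entailed S x" "0 \<le> k"
  shows "entailed S (zmul k x)"
  using assms(2)
  by (induction k rule: int_ge_induct) (simp_all add: zmul_add_one assms entailed.intros)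

lemma entailed_zmul_eq:
  assumes "entailed S x" "entailed S (- x)"
  shows "entailed S (zmul k x)"
proof (cases "0 \<le> k")
  case False
  then show ?thesis
    using entailed_zmul[OF assms(2), of "- k"] by simp
qed (simp add: entailed_zmul assms)

lemma entailed_sum: "(\<And>i. i \<in> I \<Longrightarrow> entailed S (f i)) \<Longrightarrow> entailed S (sum f I)"
  by (induction I rule: infinite_finite_induct) (simp_all add: entailed.intros)

text \<open>A deduction theorem: a derivation uses the extra inequality finitely often, and
  \<open>k\<close> counts these uses.\<close>

lemma entailed_insertD: "entailed (insert s S) x \<Longrightarrow> \<exists>k\<ge>0. entailed S (x - zmul k (pprt s))"
proof (induction rule: entailed.induct)
  case (base t)
  show ?case
  proof (cases "t = s")
    case True
    then show ?thesis by (intro exI[of _ 1]) (simp add: entailed.zero)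
  next
    case False
    then show ?thesis using base by (intro exI[of _ 0]) (simp add: entailed.base)
  qed
next
  case zero
  show ?case by (intro exI[of _ 0]) (simp add: entailed.zero)
next
  case (add x y)
  then obtain k l where "0 \<le> k" "0 \<le> l"
    "entailed S (x - zmul k (pprt s))" "entailed S (y - zmul l (pprt s))"
    by blast
  moreover from this have "entailed S ((x - zmul k (pprt s)) + (y - zmul l (pprt s)))"
    by (blast intro: entailed.add)
  moreover have "(x - zmul k (pprt s)) + (y - zmul l (pprt s)) = x + y - zmul (k + l) (pprt s)"
    by (simp add: zmul_add_left)
  ultimately show ?case
    by (intro exI[of _ "k + l"]) simp
next
  case (le y x)
  then obtain k where "0 \<le> k" "entailed S (y - zmul k (pprt s))"
    by blast
  moreover from this(2) have "entailed S (x - zmul k (pprt s))"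
    by (rule entailed.le) (rule diff_right_mono[OF le.hyps(2)])
  ultimately show ?case by blast
qed

text \<open>The two cases give entailed elements \<open>x - zmul k (pprt b)\<close> and
  \<open>x - zmul l (pprt (- b))\<close>. The subtracted multiples are still disjoint, so the
  supremum of the two elements is exactly \<open>x\<close>.\<close>

lemma entailed_split:
  assumes "entailed (insert b S) x" "entailed (insert (- b) S) x"
  shows "entailed S x"
proof -
  obtain k where k: "0 \<le> k" "entailed S (x - zmul k (pprt b))"
    using entailed_insertD[OF assms(1)] by blast
  obtain l where l: "0 \<le> l" "entailed S (x - zmul l (pprt (- b)))"
    using entailed_insertD[OF assms(2)] by blast
  have "inf (zmul k (pprt b)) (zmul l (pprt (- b))) = 0"
    using inf_pprt_uminus[of b] k(1) l(1) by (metis inf_zmul_eq_0 inf.commute)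
  then have "sup (- zmul k (pprt b)) (- zmul l (pprt (- b))) = 0"
    using neg_inf_eq_sup[of "zmul k (pprt b)" "zmul l (pprt (- b))"] by simp
  then have "sup (x - zmul k (pprt b)) (x - zmul l (pprt (- b))) = x"
    using add_sup_distrib_left[of x "- zmul k (pprt b)" "- zmul l (pprt (- b))"] by simp
  then show ?thesis
    using entailed_sup[OF k(2) l(2)] by simp
qed

text \<open>Split on the sign of \<open>x\<close>. Under x \<le> 0 nothing remains; under - x \<le>
  0, adding \<open>k - 1\<close> copies of \<open>- x\<close> to \<open>zmul k x\<close> leaves
  \<open>x\<close>. This supplies the hypothesis \<open>divide\<close> of
  \<open>farkas\<close>.\<close>

lemma entailed_divide:
  assumes "entailed S (zmul k x)" "0 < k"
  shows "entailed S x"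
proof (rule entailed_split)
  show "entailed (insert x S) x"
    by (simp add: entailed_mem)
  have "entailed (insert (- x) S) (zmul k x + zmul (k - 1) (- x))"
    using assms
    by (intro entailed.add[OF entailed_mono entailed_zmul[OF entailed_mem]]) auto
  then show "entailed (insert (- x) S) x"
    by (simp add: zmul_diff_one)
qed


section \<open>Terms modulo the equations as a type\<close>

\<comment> \<open>The congruence does not mention the number of generators, so one type with all
  generators contains a copy of every \<open>FA n\<close>. Being a type, it can carry the class
  \<open>lattice_ab_group_add\<close> with its calculus of positive parts.\<close>
quotient_type 'x fal = "'x lterm" / lterm_eq
  by (rule equivpI) (auto simp: reflp_def symp_def transp_def intro: lterm_eq.intros)

instantiation fal :: (type) lattice_ab_group_add
begin

lift_definition zero_fal :: "'a fal" is Zer .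
lift_definition plus_fal :: "'a fal \<Rightarrow> 'a fal \<Rightarrow> 'a fal" is Add by (rule lterm_eq.Add_cong)
lift_definition uminus_fal :: "'a fal \<Rightarrow> 'a fal" is Neg by (rule lterm_eq.Neg_cong)
lift_definition minus_fal :: "'a fal \<Rightarrow> 'a fal \<Rightarrow> 'a fal" is "\<lambda>s t. Add s (Neg t)"
  by (intro lterm_eq.Add_cong lterm_eq.Neg_cong)
lift_definition inf_fal :: "'a fal \<Rightarrow> 'a fal \<Rightarrow> 'a fal" is Meet by (rule lterm_eq.Meet_cong)
lift_definition sup_fal :: "'a fal \<Rightarrow> 'a fal \<Rightarrow> 'a fal" is Join by (rule lterm_eq.Join_cong)
lift_definition less_eq_fal :: "'a fal \<Rightarrow> 'a fal \<Rightarrow> bool" is "\<lambda>s t. Meet s t \<sim> s"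
  by (meson lterm_eq.Meet_cong lterm_eq.sym lterm_eq.trans)

definition less_fal :: "'a fal \<Rightarrow> 'a fal \<Rightarrow> bool"
  where "less_fal x y \<longleftrightarrow> x \<le> y \<and> \<not> y \<le> x"

instance
proof
  fix a b c :: "'a fal"
  show "(a < b) = (a \<le> b \<and> \<not> b \<le> a)" by (rule less_fal_def)
  show "a \<le> b \<Longrightarrow> c + a \<le> c + b"
    by transfer (rule lterm_eq.trans[OF lterm_eq.sym[OF lterm_eq.Add_Meet]
          lterm_eq.Add_cong[OF lterm_eq.refl]])
  show "a \<le> b \<Longrightarrow> b \<le> c \<Longrightarrow> a \<le> c" by transfer (rule Meet_eq_trans)
  show "a \<le> b \<Longrightarrow> b \<le> a \<Longrightarrow> a = b" by transfer (rule Meet_eq_antisym)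
  show "a \<le> b \<Longrightarrow> a \<le> c \<Longrightarrow> a \<le> inf b c" by transfer (rule Meet_greatest)
  show "b \<le> a \<Longrightarrow> c \<le> a \<Longrightarrow> sup b c \<le> a" by transfer (rule Join_least)
qed (transfer; rule lterm_eq.Add_assoc lterm_eq.Add_comm lterm_eq.Add_Zer lterm_eq.Add_Neg
    Meet_idem Meet_lower Join_upper lterm_eq.refl)+

end

lift_definition gen :: "'x \<Rightarrow> 'x fal" is Gen .

lemma abs_fal_simps:
  "abs_fal (Gen i) = gen i" "abs_fal Zer = 0" "abs_fal (Neg t) = - abs_fal t"
  "abs_fal (Add s t) = abs_fal s + abs_fal t" "abs_fal (Meet s t) = inf (abs_fal s) (abs_fal t)"
  "abs_fal (Join s t) = sup (abs_fal s) (abs_fal t)"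
  by (transfer; simp add: lterm_eq.refl)+

primrec leval :: "('x \<Rightarrow> int) \<Rightarrow> 'x lterm \<Rightarrow> int"
  where
    "leval z (Gen i) = z i"
  | "leval z Zer = 0"
  | "leval z (Neg t) = - leval z t"
  | "leval z (Add s t) = leval z s + leval z t"
  | "leval z (Meet s t) = min (leval z s) (leval z t)"
  | "leval z (Join s t) = max (leval z s) (leval z t)"

lift_definition ev :: "('x \<Rightarrow> int) \<Rightarrow> 'x fal \<Rightarrow> int" is leval
  subgoal for z s t by (induction rule: lterm_eq.induct) auto
  done

lemma ev_simps [simp]:
  "ev z (gen i) = z i" "ev z 0 = 0" "ev z (- x) = - ev z x" "ev z (x + y) = ev z x + ev z y"
  "ev z (x - y) = ev z x - ev z y"
  "ev z (inf x y) = min (ev z x) (ev z y)" "ev z (sup x y) = max (ev z x) (ev z y)"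
  by (transfer; simp)+

lemma ev_mono: "x \<le> y \<Longrightarrow> ev z x \<le> ev z y"
  by (metis ev_simps(6) inf.absorb_iff1 min.cobounded2)

lemma ev_zmul [simp]: "ev z (zmul k x) = k * ev z x"
  by (induction k rule: int_induct[where k = 0])
    (simp_all add: zmul_add_one zmul_diff_one algebra_simps)

lemma ev_sum [simp]: "ev z (sum f I) = (\<Sum>i\<in>I. ev z (f i))"
  by (induction I rule: infinite_finite_induct) simp_all

text \<open>An integer point is a homomorphism into the lattice-ordered group \<int>, so entailments
  survive evaluation. This gives the necessity of the tests and, applied to two opposite
  entailments, equality of values at a point.\<close>

lemma entailed_sound:
  assumes "entailed S x" "\<And>s. s \<in> S \<Longrightarrow> ev z s \<le> 0"
  shows "ev z x \<le> 0"
  using assms(1)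
proof (induction rule: entailed.induct)
  case (base s)
  then show ?case using assms(2)[of s] by (simp add: pprt_def)
next
  case (le y x)
  then show ?case using ev_mono[of x y z] by simp
qed simp_all


section \<open>Reduction to linear forms\<close>

definition lin :: "nat \<Rightarrow> (nat \<Rightarrow> int) \<Rightarrow> nat fal"
  where "lin n c = (\<Sum>i<n. zmul (c i) (gen i))"

lemma lin_simps:
  "lin n 0 = 0" "lin n (c + d) = lin n c + lin n d" "lin n (- c) = - lin n c"
  "lin n (c - d) = lin n c - lin n d" "lin n (\<lambda>i. k * c i) = zmul k (lin n c)"
  by (simp_all add: lin_def zmul.scale_left_distrib zmul.scale_left_diff_distrib sum.distrib
      sum_subtractf sum_negf zmul.scale_sum_right)

lemma lin_unit: "i < n \<Longrightarrow> lin n (\<lambda>j. if j = i then 1 else 0) = gen i"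
  by (simp add: lin_def if_distrib[of "\<lambda>k. zmul k _"] cong: if_cong)

lemma ev_lin [simp]: "ev z (lin n c) = pairing n c z"
  by (simp add: lin_def pairing_def)

definition linear_mod :: "nat \<Rightarrow> nat fal set \<Rightarrow> nat fal \<Rightarrow> bool"
  where "linear_mod n S x \<longleftrightarrow> (\<exists>c. entailed S (x - lin n c) \<and> entailed S (lin n c - x))"

lemma linear_mod_mono: "linear_mod n S x \<Longrightarrow> S \<subseteq> T \<Longrightarrow> linear_mod n T x"
  unfolding linear_mod_def by (blast intro: entailed_mono)

lemma linear_mod_lin: "linear_mod n S (lin n c)"
  unfolding linear_mod_def by (intro exI[of _ c]) (simp add: entailed.zero)

lemma linear_mod_uminus:
  assumes "linear_mod n S x"
  shows "linear_mod n S (- x)"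
proof -
  obtain c where "entailed S (x - lin n c)" "entailed S (lin n c - x)"
    using assms by (auto simp: linear_mod_def)
  then show ?thesis
    unfolding linear_mod_def by (intro exI[of _ "- c"]) (simp add: lin_simps add.commute)
qed

lemma linear_mod_add:
  assumes "linear_mod n S x" "linear_mod n S y"
  shows "linear_mod n S (x + y)"
proof -
  obtain c d where "entailed S (x - lin n c)" "entailed S (lin n c - x)"
    "entailed S (y - lin n d)" "entailed S (lin n d - y)"
    using assms by (auto simp: linear_mod_def)
  then show ?thesis
    unfolding linear_mod_def
    by (intro exI[of _ "c + d"]) (simp add: lin_simps add_diff_add entailed.add)
qed

lemma linear_mod_cong:
  assumes "linear_mod n S x" "entailed S (x - y)" "entailed S (y - x)"
  shows "linear_mod n S y"
proof -
  obtain c where "entailed S (x - lin n c)" "entailed S (lin n c - x)"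
    using assms by (auto simp: linear_mod_def)
  then have "entailed S ((y - x) + (x - lin n c))" "entailed S ((lin n c - x) + (x - y))"
    using assms by (blast intro: entailed.add)+
  then show ?thesis
    unfolding linear_mod_def by (intro exI[of _ c]) simp
qed

lemma linear_mod_inf:
  assumes "linear_mod n S x" "entailed S (x - y)"
  shows "linear_mod n S (inf x y)"
proof (rule linear_mod_cong[OF assms(1)])
  have "x - inf x y = sup 0 (x - y)"
    by (simp add: diff_inf_eq_sup add_sup_distrib_left)
  then show "entailed S (x - inf x y)"
    using assms(2) by (simp add: entailed_sup entailed.zero)
  show "entailed S (inf x y - x)"
    by (rule entailed.le[OF entailed.zero]) simp
qed

lemma linear_mod_sup:
  assumes "linear_mod n S y" "entailed S (x - y)"
  shows "linear_mod n S (sup x y)"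
proof (rule linear_mod_cong[OF assms(1)])
  have "sup x y - y = sup (x - y) 0"
    using add_sup_distrib_right[of x y "- y"] by simp
  then show "entailed S (sup x y - y)"
    using assms(2) by (simp add: entailed_sup entailed.zero)
  show "entailed S (y - sup x y)"
    by (rule entailed.le[OF entailed.zero]) (simp only: diff_le_0_iff_le sup_ge2)
qed

text \<open>The tree of case distinctions is never built: \<open>R\<close> is an arbitrary goal
  depending on the sign conditions, and \<open>split\<close> reduces it to two refinements. The
  assumptions \<open>s\<close> and \<open>t\<close> have the form of the induction hypotheses for
  the arguments of a \<open>Meet\<close> or \<open>Join\<close>. Once both are linear, with
  coefficients \<open>c\<close> and \<open>d\<close>, a single split on \<open>c - d\<close> makes
  them comparable.\<close>

lemma linearize_ordered:
  assumes split: "\<And>c L. finite L \<Longrightarrow> R (insert c L) \<Longrightarrow> R (insert (- c) L) \<Longrightarrow> R L"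
    and s: "\<And>L. finite L \<Longrightarrow>
      (\<And>L'. L \<subseteq> L' \<Longrightarrow> finite L' \<Longrightarrow> linear_mod n (lin n ` L') (abs_fal s) \<Longrightarrow> R L') \<Longrightarrow> R L"
    and t: "\<And>L. finite L \<Longrightarrow>
      (\<And>L'. L \<subseteq> L' \<Longrightarrow> finite L' \<Longrightarrow> linear_mod n (lin n ` L') (abs_fal t) \<Longrightarrow> R L') \<Longrightarrow> R L"
    and "finite L"
    and R: "\<And>L'. L \<subseteq> L' \<Longrightarrow> finite L' \<Longrightarrow> linear_mod n (lin n ` L') (abs_fal s) \<Longrightarrow>
      linear_mod n (lin n ` L') (abs_fal t) \<Longrightarrow>
      entailed (lin n ` L') (abs_fal s - abs_fal t) \<or> entailed (lin n ` L') (abs_fal t - abs_fal s) \<Longrightarrow>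
      R L'"
  shows "R L"
proof (rule s)
  fix L1 assume L1: "L \<subseteq> L1" "finite L1" "linear_mod n (lin n ` L1) (abs_fal s)"
  show "R L1"
  proof (rule t)
    fix L2 assume L2: "L1 \<subseteq> L2" "finite L2" "linear_mod n (lin n ` L2) (abs_fal t)"
    have s2: "linear_mod n (lin n ` L2) (abs_fal s)"
      using L1(3) L2(1) by (blast intro: linear_mod_mono)
    then obtain c d where
      cd: "entailed (lin n ` L2) (abs_fal s - lin n c)" "entailed (lin n ` L2) (lin n c - abs_fal s)"
        "entailed (lin n ` L2) (abs_fal t - lin n d)" "entailed (lin n ` L2) (lin n d - abs_fal t)"
      using L2(3) by (auto simp: linear_mod_def)
    have step: "R (insert b L2)"
      if "entailed (lin n ` insert b L2) (abs_fal s - abs_fal t) \<or>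
        entailed (lin n ` insert b L2) (abs_fal t - abs_fal s)" for b
      using that L1 L2 s2 by (intro R) (auto intro: linear_mod_mono)
    show "R L2"
    proof (rule split[OF L2(2)])
      \<comment> \<open>The sum collapses to the difference of the two terms: both linear
        approximations cancel against \<open>lin n (c - d)\<close>.\<close>
      have "entailed (lin n ` insert (c - d) L2)
          ((abs_fal s - lin n c) + lin n (c - d) + (lin n d - abs_fal t))"
        using cd
        by (intro entailed.add[OF entailed.add[OF entailed_mono entailed_mem] entailed_mono]) auto
      then show "R (insert (c - d) L2)"
        by (intro step) (simp add: lin_simps algebra_simps)
      have "entailed (lin n ` insert (- (c - d)) L2)
          ((abs_fal t - lin n d) + lin n (- (c - d)) + (lin n c - abs_fal s))"
        using cd
        by (intro entailed.add[OF entailed.add[OF entailed_mono entailed_mem] entailed_mono]) auto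
      then show "R (insert (- (c - d)) L2)"
        by (intro step) (simp add: lin_simps algebra_simps)
    qed
  qed (rule L1)
qed (rule \<open>finite L\<close>)

text \<open>
  Splitting on the sign of linear forms turns every term into a linear form: at a \<open>Meet\<close>
  or \<open>Join\<close> of two terms that are already linear, split on the sign of their difference.
\<close>

lemma linearize:
  assumes split: "\<And>c L. finite L \<Longrightarrow> R (insert c L) \<Longrightarrow> R (insert (- c) L) \<Longrightarrow> R L"
    and "t \<in> lterms n" "finite L"
    and "\<And>L'. L \<subseteq> L' \<Longrightarrow> finite L' \<Longrightarrow> linear_mod n (lin n ` L') (abs_fal t) \<Longrightarrow> R L'"
  shows "R L"
  using assms(2-)
proof (induction t arbitrary: L)
  case (Gen i)
  then show ?case
    using linear_mod_lin[of n "lin n ` L" "\<lambda>j. if j = i then 1 else 0"]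
    by (auto simp: lin_unit abs_fal_simps)
next
  case Zer
  then show ?case
    using linear_mod_lin[of n "lin n ` L" 0] by (simp add: lin_simps abs_fal_simps)
next
  case (Neg t)
  show ?case
  proof (rule Neg.IH)
    show "R L'" if "L \<subseteq> L'" "finite L'" "linear_mod n (lin n ` L') (abs_fal t)" for L'
      using that linear_mod_uminus by (intro Neg.prems(3)) (simp_all add: abs_fal_simps)
  qed (use Neg.prems(1,2) in simp_all)
next
  case (Add s t)
  show ?case
  proof (rule Add.IH(1))
    fix L1 assume L1: "L \<subseteq> L1" "finite L1" "linear_mod n (lin n ` L1) (abs_fal s)"
    show "R L1"
    proof (rule Add.IH(2))
      fix L2 assume L2: "L1 \<subseteq> L2" "finite L2" "linear_mod n (lin n ` L2) (abs_fal t)"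
      have "linear_mod n (lin n ` L2) (abs_fal s)"
        using L1(3) L2(1) by (blast intro: linear_mod_mono)
      then show "R L2"
        using L1(1) L2 by (intro Add.prems(3)) (simp_all add: abs_fal_simps linear_mod_add)
    qed (use Add.prems(1) L1(2) in simp_all)
  qed (use Add.prems(1,2) in simp_all)
next
  case (Meet s t)
  show ?case
  proof (rule linearize_ordered[of R n s t L])
    fix L' assume L': "L \<subseteq> L'" "finite L'"
      "linear_mod n (lin n ` L') (abs_fal s)" "linear_mod n (lin n ` L') (abs_fal t)"
      "entailed (lin n ` L') (abs_fal s - abs_fal t) \<or> entailed (lin n ` L') (abs_fal t - abs_fal s)"
    have "linear_mod n (lin n ` L') (inf (abs_fal s) (abs_fal t))"
      using L'(3-5) by (metis linear_mod_inf inf.commute)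
    then show "R L'"
      using L'(1,2) by (intro Meet.prems(3)) (simp_all add: abs_fal_simps)
  next
    have "s \<in> lterms n" "t \<in> lterms n" using Meet.prems(1) by simp_all
    show "R L"
      if "finite L" "\<And>L'. L \<subseteq> L' \<Longrightarrow> finite L' \<Longrightarrow> linear_mod n (lin n ` L') (abs_fal s) \<Longrightarrow> R L'"
      for L
      using \<open>s \<in> lterms n\<close> that by (rule Meet.IH(1))
    show "R L"
      if "finite L" "\<And>L'. L \<subseteq> L' \<Longrightarrow> finite L' \<Longrightarrow> linear_mod n (lin n ` L') (abs_fal t) \<Longrightarrow> R L'"
      for L
      using \<open>t \<in> lterms n\<close> that by (rule Meet.IH(2))
  qed (fact split Meet.prems(2))+
next
  case (Join s t)
  show ?case
  proof (rule linearize_ordered[of R n s t L])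
    fix L' assume L': "L \<subseteq> L'" "finite L'"
      "linear_mod n (lin n ` L') (abs_fal s)" "linear_mod n (lin n ` L') (abs_fal t)"
      "entailed (lin n ` L') (abs_fal s - abs_fal t) \<or> entailed (lin n ` L') (abs_fal t - abs_fal s)"
    have "linear_mod n (lin n ` L') (sup (abs_fal s) (abs_fal t))"
      using L'(3-5) by (metis linear_mod_sup sup.commute)
    then show "R L'"
      using L'(1,2) by (intro Join.prems(3)) (simp_all add: abs_fal_simps)
  next
    have "s \<in> lterms n" "t \<in> lterms n" using Join.prems(1) by simp_all
    show "R L"
      if "finite L" "\<And>L'. L \<subseteq> L' \<Longrightarrow> finite L' \<Longrightarrow> linear_mod n (lin n ` L') (abs_fal s) \<Longrightarrow> R L'"
      for L
      using \<open>s \<in> lterms n\<close> that by (rule Join.IH(1))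
    show "R L"
      if "finite L" "\<And>L'. L \<subseteq> L' \<Longrightarrow> finite L' \<Longrightarrow> linear_mod n (lin n ` L') (abs_fal t) \<Longrightarrow> R L'"
      for L
      using \<open>t \<in> lterms n\<close> that by (rule Join.IH(2))
  qed (fact split Join.prems(2))+
qed

text \<open>The terms are treated one after another. Sign conditions are only ever added, so a term
  that has become linear stays linear.\<close>

lemma linearize_set:
  assumes split: "\<And>c L. finite L \<Longrightarrow> R (insert c L) \<Longrightarrow> R (insert (- c) L) \<Longrightarrow> R L"
    and "finite T" "T \<subseteq> lterms n" "finite L"
    and "\<And>L'. L \<subseteq> L' \<Longrightarrow> finite L' \<Longrightarrow>
      \<forall>t \<in> T. linear_mod n (lin n ` L') (abs_fal t) \<Longrightarrow> R L'"
  shows "R L"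
  using assms(2-)
proof (induction T arbitrary: L rule: finite_induct)
  case (insert t T)
  show ?case
  proof (rule linearize[of R t n])
    fix L1 assume L1: "L \<subseteq> L1" "finite L1" "linear_mod n (lin n ` L1) (abs_fal t)"
    show "R L1"
    proof (rule insert.IH)
      fix L2 assume L2: "L1 \<subseteq> L2" "finite L2" "\<forall>t \<in> T. linear_mod n (lin n ` L2) (abs_fal t)"
      have "linear_mod n (lin n ` L2) (abs_fal t)"
        using L1(3) L2(1) by (blast intro: linear_mod_mono)
      then show "R L2"
        using L1(1) L2 by (intro insert.prems(3)) simp_all
    qed (use insert.prems(1) L1(2) in simp_all)
  qed (use insert.prems(1,2) split in simp_all)
qed simp

text \<open>
  In each case of the splitting the relations \<open>T\<close> and the forms \<open>ts\<close> are linear, so Farkas'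
  lemma applies, and finitely many integer points generate the dual cone.
\<close>

lemma entailed_finite_test:
  fixes k :: nat
  assumes T: "finite T" "T \<subseteq> lterms n" and ts: "\<And>i. i < k \<Longrightarrow> ts i \<in> lterms n"
  shows "\<exists>V. finite V \<and> (\<forall>\<xi>. entailed (abs_fal ` T) (\<Sum>i<k. zmul (\<xi> i) (abs_fal (ts i))) \<longleftrightarrow>
    (\<forall>z \<in> V. (\<Sum>i<k. \<xi> i * leval z (ts i)) \<le> 0))"
proof -
  define S where "S = abs_fal ` T"
  define f where "f \<xi> = (\<Sum>i<k. zmul (\<xi> i) (abs_fal (ts i)))" for \<xi>
  have ev_f: "ev z (f \<xi>) = (\<Sum>i<k. \<xi> i * leval z (ts i))" for z \<xi>
    by (simp add: f_def ev.abs_eq)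
  \<comment> \<open>The points have to respect the relations \<open>S\<close> but not the sign
    conditions \<open>L\<close>; hence the test sets of the two branches of a split can simply be
    united. At \<open>L = {}\<close> the second clause becomes the completeness of the
    tests.\<close>
  define tests where "tests V L \<longleftrightarrow> finite V \<and> (\<forall>z \<in> V. \<forall>s \<in> S. ev z s \<le> 0) \<and>
    (\<forall>\<xi>. (\<forall>z \<in> V. ev z (f \<xi>) \<le> 0) \<longrightarrow> entailed (S \<union> lin n ` L) (f \<xi>))" for V L
  define R where "R L \<longleftrightarrow> (\<exists>V. tests V L)" for L
  have "R {}"
  proof (rule linearize_set[of R "T \<union> ts ` {..<k}" n])
    fix c L assume "R (insert c L)" "R (insert (- c) L)"
    from this(1) obtain V1 where V1: "tests V1 (insert c L)" unfolding R_def ..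
    from \<open>R (insert (- c) L)\<close> obtain V2 where V2: "tests V2 (insert (- c) L)"
      unfolding R_def ..
    have "entailed (S \<union> lin n ` L) (f \<xi>)" if "\<forall>z \<in> V1 \<union> V2. ev z (f \<xi>) \<le> 0" for \<xi>
    proof (rule entailed_split[of "lin n c"])
      show "entailed (insert (lin n c) (S \<union> lin n ` L)) (f \<xi>)"
        using V1 that by (simp add: tests_def)
      show "entailed (insert (- lin n c) (S \<union> lin n ` L)) (f \<xi>)"
        using V2 that by (simp add: tests_def lin_simps)
    qed
    then have "tests (V1 \<union> V2) L"
      using V1 V2 unfolding tests_def by blast
    then show "R L"
      unfolding R_def by (rule exI)
  next
    fix L :: "(nat \<Rightarrow> int) set"
    assume L: "finite L" and "\<forall>t \<in> T \<union> ts ` {..<k}. linear_mod n (lin n ` L) (abs_fal t)"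
    then have "\<forall>t \<in> T \<union> ts ` {..<k}. \<exists>c. entailed (lin n ` L) (abs_fal t - lin n c) \<and>
        entailed (lin n ` L) (lin n c - abs_fal t)"
      by (simp add: linear_mod_def)
    from bchoice[OF this] obtain m where
      "\<forall>t \<in> T \<union> ts ` {..<k}. entailed (lin n ` L) (abs_fal t - lin n (m t)) \<and>
        entailed (lin n ` L) (lin n (m t) - abs_fal t)" ..
    then have m: "entailed (lin n ` L) (abs_fal t - lin n (m t))"
        "entailed (lin n ` L) (lin n (m t) - abs_fal t)" if "t \<in> T \<union> ts ` {..<k}" for t
      using that by simp_all
    \<comment> \<open>The region is cut out by the sign conditions together with the linearized
      relations, all of them linear forms now.\<close>
    have "finite (L \<union> m ` T)" using L T(1) by simp
    from cone_finite_test[OF this, of n] obtain V where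
      *: "finite V \<and> (\<forall>z \<in> V. \<forall>l \<in> L \<union> m ` T. pairing n l z \<le> 0) \<and>
        (\<forall>u x. (\<forall>z \<in> V. pairing n u z \<le> 0) \<longrightarrow>
          (\<forall>l \<in> L \<union> m ` T. pairing n l x \<le> 0) \<longrightarrow> pairing n u x \<le> 0)" ..
    then have V: "finite V" by simp
    have V_le: "pairing n l z \<le> 0" if "z \<in> V" "l \<in> L \<union> m ` T" for z l
      using * that by blast
    have V_test: "pairing n u x \<le> 0"
      if "\<And>z. z \<in> V \<Longrightarrow> pairing n u z \<le> 0" "\<And>l. l \<in> L \<union> m ` T \<Longrightarrow> pairing n l x \<le> 0" for u x
      using * that by blast
    have ev_m: "ev z (abs_fal t) = pairing n (m t) z" if "z \<in> V" "t \<in> T \<union> ts ` {..<k}" for z t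
    proof -
      have *: "ev z s \<le> 0" if "s \<in> lin n ` L" for s
        using that V_le[OF \<open>z \<in> V\<close>] by auto
      show ?thesis
        using entailed_sound[OF m(1)[OF that(2)] *] entailed_sound[OF m(2)[OF that(2)] *] by simp
    qed
    have "tests V L"
      unfolding tests_def
    proof (intro conjI allI impI ballI)
      show "ev z s \<le> 0" if "z \<in> V" "s \<in> S" for z s
        using that ev_m[of z] V_le[of z] by (auto simp: S_def)
      fix \<xi> assume \<xi>: "\<forall>z \<in> V. ev z (f \<xi>) \<le> 0"
      \<comment> \<open>The coefficients of the linear form that equals \<open>f \<xi>\<close>
        modulo \<open>L\<close>.\<close>
      define u where "u = (\<lambda>j. \<Sum>i<k. \<xi> i * m (ts i) j)"
      have u: "pairing n u z = (\<Sum>i<k. \<xi> i * pairing n (m (ts i)) z)" for z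
        unfolding u_def pairing_def sum_distrib_left sum_distrib_right
        by (subst sum.swap) (simp add: mult.assoc)
      have lin_u: "lin n u = (\<Sum>i<k. zmul (\<xi> i) (lin n (m (ts i))))"
        unfolding u_def lin_def zmul.scale_sum_left zmul.scale_sum_right
        by (subst sum.swap) simp
      define E where "E = entailed (S \<union> lin n ` L)"
      have E_L: "E x" if "entailed (lin n ` L) x" for x
        unfolding E_def using that by (rule entailed_mono) simp
      \<comment> \<open>Taking the entailed forms themselves as the cone \<open>K\<close> turns the
        conclusion of Farkas' lemma directly into an entailment.\<close>
      have "u \<in> {c. E (lin n c)}"
      proof (rule farkas[of "L \<union> m ` T"])
        show "finite (L \<union> m ` T)" by fact
        have "E (lin n (m t))" if "t \<in> T" for t
        proof -
          have "E ((lin n (m t) - abs_fal t) + abs_fal t)"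
            using E_L[OF m(2)[of t]] that unfolding E_def
            by (intro entailed.add[OF _ entailed_mem]) (simp_all add: S_def)
          then show ?thesis by simp
        qed
        then show "L \<union> m ` T \<subseteq> {c. E (lin n c)}"
          by (auto simp: E_def entailed_mem)
        show "c \<in> {c. E (lin n c)}" if "\<And>i. i < n \<Longrightarrow> c i = 0" for c
          using that by (simp add: lin_def E_def entailed.zero)
        show "pairing n u x \<le> 0" if "\<And>l. l \<in> L \<union> m ` T \<Longrightarrow> pairing n l x \<le> 0" for x
        proof (rule V_test[OF _ that])
          fix z assume "z \<in> V"
          then have "pairing n u z = ev z (f \<xi>)"
            using ev_m[of z] by (simp add: u f_def)
          with \<xi> \<open>z \<in> V\<close> show "pairing n u z \<le> 0" by simp
        qed
        show "c \<in> {c. E (lin n c)}" if "(\<lambda>i. j * c i) \<in> {c. E (lin n c)}" "0 < j" for c j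
          using that entailed_divide unfolding E_def mem_Collect_eq lin_simps by blast
      qed (simp_all add: E_def lin_simps entailed.add entailed_zmul)
      moreover have "E (zmul (\<xi> i) (abs_fal (ts i) - lin n (m (ts i))))" if "i < k" for i
        using E_L[OF m(1)[of "ts i"]] E_L[OF m(2)[of "ts i"]] that
        unfolding E_def by (intro entailed_zmul_eq) auto
      ultimately have "E (lin n u + (\<Sum>i<k. zmul (\<xi> i) (abs_fal (ts i) - lin n (m (ts i)))))"
        unfolding E_def by (intro entailed.add[OF _ entailed_sum]) simp_all
      then show "entailed (S \<union> lin n ` L) (f \<xi>)"
        by (simp add: E_def lin_u f_def zmul.scale_right_diff_distrib sum_subtractf)
    qed (rule V)
    then show "R L"
      unfolding R_def by (rule exI)
  qed (use T ts in auto)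
  then obtain V where V: "finite V" "\<forall>z \<in> V. \<forall>s \<in> S. ev z s \<le> 0"
    "\<forall>\<xi>. (\<forall>z \<in> V. ev z (f \<xi>) \<le> 0) \<longrightarrow> entailed S (f \<xi>)"
    unfolding R_def tests_def by auto
  have "entailed S (f \<xi>) \<longleftrightarrow> (\<forall>z \<in> V. ev z (f \<xi>) \<le> 0)" for \<xi>
    using V(2,3) entailed_sound by blast
  then show ?thesis
    using V(1) unfolding ev_f unfolding f_def S_def by blast
qed

section \<open>Quotients by finitely generated ideals\<close>

context comm_lgroup
begin

lemma leq_iff_meet: "x \<in> carrier G \<Longrightarrow> y \<in> carrier G \<Longrightarrow> x \<preceq> y \<longleftrightarrow> x \<and>\<^sub>G y = x"
  using le_iff_join[of x y] by auto

text \<open>The hull is an intersection of \<ell>-ideals; the family is nonempty because the whole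
  group belongs to it.\<close>

lemma l_ideal_hull:
  assumes "S \<subseteq> carrier G"
  shows "l_ideal ((\<lambda>J. l_ideal J G) hull S) G"
proof -
  define \<J> where "\<J> = {J. l_ideal J G \<and> S \<subseteq> J}"
  have "l_ideal (carrier G) G"
    using subgroup_self by (simp add: l_ideal_def)
  then have "\<J> \<noteq> {}"
    using assms by (auto simp: \<J>_def)
  moreover have J: "l_ideal J G" if "J \<in> \<J>" for J
    using that by (simp add: \<J>_def)
  moreover from this have "subgroup J G" if "J \<in> \<J>" for J
    using that by (simp add: l_ideal_def)
  ultimately have "subgroup (\<Inter>\<J>) G"
    by (intro subgroups_Inter)
  then have "l_ideal (\<Inter>\<J>) G"
    unfolding l_ideal_def
  proof (intro conjI ballI impI InterI)
    fix x y z J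
    assume "x \<in> \<Inter>\<J>" "z \<in> \<Inter>\<J>" "y \<in> carrier G" "x \<preceq> y \<and> y \<preceq> z" "J \<in> \<J>"
    with J[of J] show "y \<in> J"
      unfolding l_ideal_def by (meson InterD)
  next
    fix x y J
    assume "x \<in> \<Inter>\<J>" "y \<in> \<Inter>\<J>" "J \<in> \<J>"
    with J[of J] show "x \<and>\<^sub>G y \<in> J" "x \<or>\<^sub>G y \<in> J"
      unfolding l_ideal_def by (meson InterD)+
  qed
  then show ?thesis
    by (simp add: hull_def \<J>_def)
qed

context
  fixes I
  assumes I: "l_ideal I G"
begin

lemma ideal_normal: "I \<lhd> G"
  using I by (intro subgroup_imp_normal) (simp add: l_ideal_def)

lemma quot_carrier: "carrier (quot_lgroup G I) = (\<lambda>x. I #> x) ` carrier G"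
  by (simp add: quot_lgroup_def carrier_FactGroup)

lemma quot_mult:
  assumes "x \<in> carrier G" "y \<in> carrier G"
  shows "(I #> x) \<otimes>\<^bsub>quot_lgroup G I\<^esub> (I #> y) = I #> (x \<otimes> y)"
  using assms by (simp add: quot_lgroup_def FactGroup_def normal.rcos_sum[OF ideal_normal])

lemma quot_leq_iff:
  assumes "x \<in> carrier G" "y \<in> carrier G"
  shows "(I #> x) \<preceq>\<^bsub>quot_lgroup G I\<^esub> (I #> y) \<longleftrightarrow> (\<exists>i \<in> I. x \<preceq> i \<otimes> y)"
proof -
  interpret I: normal I G by (rule ideal_normal)
  have IG [simp]: "i \<in> carrier G" if "i \<in> I" for i
    using that I.subset by auto
  show ?thesis
  proof
    assume "(I #> x) \<preceq>\<^bsub>quot_lgroup G I\<^esub> (I #> y)"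
    then obtain i j where ij: "i \<in> I" "j \<in> I" "i \<otimes> x \<preceq> j \<otimes> y"
      by (auto simp: quot_lgroup_def r_coset_def)
    then have "x \<preceq> (inv i \<otimes> j) \<otimes> y"
      using assms leq_inv_mult(1)[of x "j \<otimes> y" i] by (simp add: m_assoc)
    with ij show "\<exists>i \<in> I. x \<preceq> i \<otimes> y"
      by (intro bexI[of _ "inv i \<otimes> j"]) auto
  next
    assume "\<exists>i \<in> I. x \<preceq> i \<otimes> y"
    then obtain i where "i \<in> I" "x \<preceq> i \<otimes> y" by blast
    moreover have "x \<in> I #> x"
      using rcos_self[OF assms(1) I.subgroup_axioms] .
    ultimately show "(I #> x) \<preceq>\<^bsub>quot_lgroup G I\<^esub> (I #> y)"
      unfolding quot_lgroup_def po_group.simps r_coset_def by blast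
  qed
qed

text \<open>Meets and joins of the quotient are given only through its order, so they are compared
  with the images by antisymmetry. The harder inequality lifts the bound to some \<open>z\<close>;
  the two ideal elements witnessing its comparisons are merged into their join, which lies in
  \<open>I\<close>.\<close>

lemma quot_lgroup_hom: "(\<lambda>x. I #> x) \<in> lgroup_hom G (quot_lgroup G I)"
proof -
  interpret I: normal I G by (rule ideal_normal)
  interpret Q: comm_lgroup "quot_lgroup G I"
    using comm_lgroup_axioms I by (rule quot_comm_lgroup)
  have IG [simp]: "i \<in> carrier G" if "i \<in> I" for i
    using that I.subset by auto
  have I_join: "i \<or>\<^sub>G j \<in> I" if "i \<in> I" "j \<in> I" for i j
    using I that unfolding l_ideal_def by blast
  have Q: "I #> x \<in> carrier (quot_lgroup G I)" if "x \<in> carrier G" for x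
    using that by (simp add: quot_carrier)
  have mono: "(I #> x) \<preceq>\<^bsub>quot_lgroup G I\<^esub> (I #> y)"
    if "x \<in> carrier G" "y \<in> carrier G" "x \<preceq> y" for x y
    using that by (auto simp: quot_leq_iff intro!: bexI[of _ \<one>])
  have shift: "u \<preceq> (i \<or>\<^sub>G j) \<otimes> v" "u \<preceq> (j \<or>\<^sub>G i) \<otimes> v"
    if "u \<in> carrier G" "v \<in> carrier G" "i \<in> I" "j \<in> I" "u \<preceq> i \<otimes> v" for u v i j
  proof -
    have "v \<otimes> i \<preceq> v \<otimes> (i \<or>\<^sub>G j)" "v \<otimes> i \<preceq> v \<otimes> (j \<or>\<^sub>G i)"
      using that join_left[of i j] join_right[of j i] by (simp_all add: leq_mult_left)
    with that show "u \<preceq> (i \<or>\<^sub>G j) \<otimes> v" "u \<preceq> (j \<or>\<^sub>G i) \<otimes> v"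
      using le_trans[simplified, of u "i \<otimes> v"] by (simp_all add: m_comm)
  qed
  have meet: "I #> (x \<and>\<^sub>G y) = (I #> x) \<sqinter>\<^bsub>po_of (quot_lgroup G I)\<^esub> (I #> y)"
    if xy: "x \<in> carrier G" "y \<in> carrier G" for x y
  proof (rule Q.le_antisym[simplified])
    show "I #> (x \<and>\<^sub>G y) \<preceq>\<^bsub>quot_lgroup G I\<^esub> (I #> x) \<sqinter>\<^bsub>po_of (quot_lgroup G I)\<^esub> (I #> y)"
      using xy meet_left[of x y] meet_right[of x y]
      by (intro Q.meet_le[simplified] mono) (auto simp: Q)
    obtain z where z: "z \<in> carrier G" "(I #> x) \<sqinter>\<^bsub>po_of (quot_lgroup G I)\<^esub> (I #> y) = I #> z"
      using Q.gclosed(1)[of "I #> x" "I #> y"] xy Q unfolding quot_carrier by blast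
    have "(I #> z) \<preceq>\<^bsub>quot_lgroup G I\<^esub> (I #> x)" "(I #> z) \<preceq>\<^bsub>quot_lgroup G I\<^esub> (I #> y)"
      unfolding z(2)[symmetric]
      using Q.meet_left[of "I #> x" "I #> y"] Q.meet_right[of "I #> x" "I #> y"] xy
      by (simp_all add: Q)
    then obtain i j where ij: "i \<in> I" "j \<in> I" "z \<preceq> i \<otimes> x" "z \<preceq> j \<otimes> y"
      using xy z(1) by (auto simp: quot_leq_iff)
    then have "z \<preceq> (i \<or>\<^sub>G j) \<otimes> (x \<and>\<^sub>G y)"
      using xy z(1) shift(1)[of z x i j] shift(2)[of z y j i]
      by (simp add: mult_meet_distrib meet_le[simplified])
    then show "(I #> x) \<sqinter>\<^bsub>po_of (quot_lgroup G I)\<^esub> (I #> y) \<preceq>\<^bsub>quot_lgroup G I\<^esub> I #> (x \<and>\<^sub>G y)"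
      using ij xy z I_join by (auto simp: quot_leq_iff)
  qed (use xy in \<open>simp_all add: Q\<close>)
  have join: "I #> (x \<or>\<^sub>G y) = (I #> x) \<squnion>\<^bsub>po_of (quot_lgroup G I)\<^esub> (I #> y)"
    if xy: "x \<in> carrier G" "y \<in> carrier G" for x y
  proof (rule Q.le_antisym[simplified])
    show "(I #> x) \<squnion>\<^bsub>po_of (quot_lgroup G I)\<^esub> (I #> y) \<preceq>\<^bsub>quot_lgroup G I\<^esub> I #> (x \<or>\<^sub>G y)"
      using xy join_left[of x y] join_right[of x y]
      by (intro Q.join_le[simplified] mono) (auto simp: Q)
    obtain z where z: "z \<in> carrier G" "(I #> x) \<squnion>\<^bsub>po_of (quot_lgroup G I)\<^esub> (I #> y) = I #> z"
      using Q.gclosed(2)[of "I #> x" "I #> y"] xy Q unfolding quot_carrier by blast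
    have "(I #> x) \<preceq>\<^bsub>quot_lgroup G I\<^esub> (I #> z)" "(I #> y) \<preceq>\<^bsub>quot_lgroup G I\<^esub> (I #> z)"
      unfolding z(2)[symmetric]
      using Q.join_left[of "I #> x" "I #> y"] Q.join_right[of "I #> x" "I #> y"] xy
      by (simp_all add: Q)
    then obtain i j where ij: "i \<in> I" "j \<in> I" "x \<preceq> i \<otimes> z" "y \<preceq> j \<otimes> z"
      using xy z(1) by (auto simp: quot_leq_iff)
    then have "x \<or>\<^sub>G y \<preceq> (i \<or>\<^sub>G j) \<otimes> z"
      using xy z(1) shift(1)[of x z i j] shift(2)[of y z j i]
      by (simp add: join_le[simplified])
    then show "I #> (x \<or>\<^sub>G y) \<preceq>\<^bsub>quot_lgroup G I\<^esub> (I #> x) \<squnion>\<^bsub>po_of (quot_lgroup G I)\<^esub> (I #> y)"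
      using ij xy z I_join by (auto simp: quot_leq_iff)
  qed (use xy in \<open>simp_all add: Q\<close>)
  show ?thesis
    unfolding lgroup_hom_def hom_def join_pres_def meet_pres_def
    using lattice_axioms Q.lattice_axioms by (simp add: Q quot_mult meet join)
qed

end

end

lemma lgroup_hom_lterm_eval:
  assumes "comm_lgroup G" "comm_lgroup H" and k: "k \<in> lgroup_hom G H"
    and g: "\<And>i. g i \<in> carrier G"
  shows "k (comm_lgroup.lterm_eval G g t) = comm_lgroup.lterm_eval H (\<lambda>i. k (g i)) t"
proof -
  interpret G: comm_lgroup G by fact
  interpret H: comm_lgroup H by fact
  interpret k: group_hom G H k
    using k by unfold_locales (simp add: lgroup_hom_def)
  have "G.lterm_eval g u \<in> carrier G" for u
    by (rule G.lterm_eval_closed) (rule g)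
  then show ?thesis
    using k by (induction t) (simp_all add: lgroup_hom_def join_pres_def meet_pres_def)
qed

text \<open>The order is recovered from the meet, which an injective homomorphism both preserves and
  reflects.\<close>

lemma lgroup_hom_leq_iff:
  assumes "comm_lgroup G" "comm_lgroup H" and k: "k \<in> lgroup_hom G H" "inj_on k (carrier G)"
    and "x \<in> carrier G" "y \<in> carrier G"
  shows "x \<preceq>\<^bsub>G\<^esub> y \<longleftrightarrow> k x \<preceq>\<^bsub>H\<^esub> k y"
proof -
  interpret G: comm_lgroup G by fact
  interpret H: comm_lgroup H by fact
  have "k x \<in> carrier H" "k y \<in> carrier H"
    using assms by (auto simp: lgroup_hom_def hom_def)
  moreover have "k (x \<sqinter>\<^bsub>po_of G\<^esub> y) = k x \<sqinter>\<^bsub>po_of H\<^esub> k y"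
    using assms by (simp add: lgroup_hom_def meet_pres_def)
  ultimately show ?thesis
    using assms inj_on_eq_iff[OF k(2)] by (metis G.leq_iff_meet H.leq_iff_meet G.gclosed(1))
qed

lemma inv_FA: "t \<in> lterms n \<Longrightarrow> inv\<^bsub>FA n\<^esub> lclass n t = lclass n (Neg t)"
  by (rule FA.inv_equality)
    (simp_all add: carrier_FA mult_FA one_FA lclass_eq_iff lterm_eq.Add_Neg)

lemma lterm_eval_FA:
  assumes "t \<in> lterms n" "\<And>i. i < n \<Longrightarrow> g i = lclass n (Gen i)"
  shows "FA.lterm_eval n g t = lclass n t"
  using assms(1)
  by (induction t) (simp_all add: assms(2) one_FA inv_FA mult_FA meet_FA join_FA)

lemma leq_FA_iff:
  "s \<in> lterms n \<Longrightarrow> t \<in> lterms n \<Longrightarrow> lclass n s \<preceq>\<^bsub>FA n\<^esub> lclass n t \<longleftrightarrow> abs_fal s \<le> abs_fal t"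
  by (simp add: leq_FA less_eq_fal.abs_eq)

lemma lclass_eq_iff_abs:
  "s \<in> lterms n \<Longrightarrow> t \<in> lterms n \<Longrightarrow> lclass n s = lclass n t \<longleftrightarrow> abs_fal s = abs_fal t"
  by (simp add: lclass_eq_iff fal.abs_eq_iff)

text \<open>The bridge from the quotient order to \<open>entailed\<close>. The ideal imposes
  \<open>s = 0\<close> where \<open>entailed\<close> imposes only s \<le> 0, so each generator
  appears with both signs.\<close>

lemma hull_entailed:
  assumes T0: "T0 \<subseteq> lterms n" and t: "t \<in> lterms n"
  defines "I \<equiv> (\<lambda>J. l_ideal J (FA n)) hull (lclass n ` T0)"
  shows "(\<exists>i \<in> I. \<one>\<^bsub>FA n\<^esub> \<preceq>\<^bsub>FA n\<^esub> i \<otimes>\<^bsub>FA n\<^esub> lclass n t) \<longleftrightarrow>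
    entailed (abs_fal ` (T0 \<union> Neg ` T0)) (- abs_fal t)" (is "_ \<longleftrightarrow> entailed ?E _")
proof -
  \<comment> \<open>Entailed elements alone form only a down-set; asking for both signs yields an
    \<ell>-ideal containing the generators, hence the hull.\<close>
  define J where "J = lclass n ` {s \<in> lterms n. entailed ?E (abs_fal s) \<and> entailed ?E (- abs_fal s)}"
  have J_iff: "lclass n s \<in> J \<longleftrightarrow> entailed ?E (abs_fal s) \<and> entailed ?E (- abs_fal s)"
    if "s \<in> lterms n" for s
    using that lclass_eq_iff_abs[of s n] by (auto simp: J_def image_iff)
  have T0_G: "lclass n ` T0 \<subseteq> carrier (FA n)"
    using T0 by (auto simp: carrier_FA)
  have I: "l_ideal I (FA n)"
    unfolding I_def by (rule FA.l_ideal_hull[OF T0_G])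
  then interpret I: subgroup I "FA n"
    unfolding l_ideal_def by (rule conjunct1)
  have I_join: "x \<squnion>\<^bsub>po_of (FA n)\<^esub> y \<in> I" if "x \<in> I" "y \<in> I" for x y
    using I that unfolding l_ideal_def by blast
  have J_cases: "\<exists>s \<in> lterms n. x = lclass n s \<and> entailed ?E (abs_fal s) \<and> entailed ?E (- abs_fal s)"
    if "x \<in> J" for x
    using that by (auto simp: J_def)
  have "l_ideal J (FA n)"
    unfolding l_ideal_def
  proof (intro conjI ballI impI)
    show "subgroup J (FA n)"
    proof
      show "J \<subseteq> carrier (FA n)" by (auto simp: J_def carrier_FA)
      show "\<one>\<^bsub>FA n\<^esub> \<in> J" by (simp add: one_FA J_iff abs_fal_simps entailed.zero)
      fix x assume "x \<in> J"
      then obtain s where s: "s \<in> lterms n" "x = lclass n s"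
        "entailed ?E (abs_fal s)" "entailed ?E (- abs_fal s)"
        using J_cases by blast
      then show "inv\<^bsub>FA n\<^esub> x \<in> J" by (simp add: inv_FA J_iff abs_fal_simps)
      fix y assume "y \<in> J"
      then obtain s' where "s' \<in> lterms n" "y = lclass n s'"
        "entailed ?E (abs_fal s')" "entailed ?E (- abs_fal s')"
        using J_cases by blast
      with s show "x \<otimes>\<^bsub>FA n\<^esub> y \<in> J"
        using entailed.add[of ?E "- abs_fal s" "- abs_fal s'"]
        by (simp add: mult_FA J_iff abs_fal_simps entailed.add)
    qed
    fix x z assume "x \<in> J" "z \<in> J"
    then obtain s u where s: "s \<in> lterms n" "x = lclass n s"
        "entailed ?E (abs_fal s)" "entailed ?E (- abs_fal s)"
      and u: "u \<in> lterms n" "z = lclass n u"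
        "entailed ?E (abs_fal u)" "entailed ?E (- abs_fal u)"
      using J_cases by meson
    show "y \<in> J" if y: "y \<in> carrier (FA n)" "x \<preceq>\<^bsub>FA n\<^esub> y \<and> y \<preceq>\<^bsub>FA n\<^esub> z" for y
    proof -
      obtain v where v: "v \<in> lterms n" "y = lclass n v"
        using y(1) by (auto simp: carrier_FA)
      then have le: "abs_fal v \<le> abs_fal u" "- abs_fal v \<le> - abs_fal s"
        using y(2) s u by (simp_all add: leq_FA_iff)
      show ?thesis
        using entailed.le[OF u(3) le(1)] entailed.le[OF s(4) le(2)] v by (simp add: J_iff)
    qed
    have sup: "entailed ?E (sup a b)" "entailed ?E (inf a b)"
      if "entailed ?E a" "entailed ?E b" for a b
      using that by (simp_all add: entailed_sup entailed.le[OF that(1) inf_le1])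
    show "x \<sqinter>\<^bsub>po_of (FA n)\<^esub> z \<in> J" "x \<squnion>\<^bsub>po_of (FA n)\<^esub> z \<in> J"
      using s u by (simp_all add: meet_FA join_FA J_iff abs_fal_simps neg_inf_eq_sup neg_sup_eq_inf sup)
  qed
  moreover have "lclass n ` T0 \<subseteq> J"
  proof (intro image_subsetI)
    fix s assume "s \<in> T0"
    moreover from this have "- abs_fal s \<in> ?E" "abs_fal s \<in> ?E"
      by (auto simp: image_Un image_image abs_fal_simps)
    ultimately show "lclass n s \<in> J"
      using T0 by (subst J_iff) (auto intro: entailed_mem)
  qed
  ultimately have IJ: "I \<subseteq> J"
    unfolding I_def by (intro hull_minimal)
  \<comment> \<open>An entailed element need not lie in \<open>I\<close>, only below a member of it.
    For \<open>base\<close> this member is the positive part itself, a join with zero.\<close>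
  have bound: "\<exists>s \<in> lterms n. lclass n s \<in> I \<and> x \<le> abs_fal s" if "entailed ?E x" for x
    using that
  proof (induction rule: entailed.induct)
    case (base e)
    then obtain s where s: "s \<in> T0 \<union> Neg ` T0" "e = abs_fal s" by blast
    have T0I: "lclass n s' \<in> I" if "s' \<in> T0" for s'
      unfolding I_def using that by (intro hull_inc) blast
    have "s \<in> lterms n \<and> lclass n s \<in> I"
      using s(1)
    proof
      assume "s \<in> Neg ` T0"
      then obtain s' where "s' \<in> T0" "s = Neg s'" by blast
      moreover from this(1) have "s' \<in> lterms n" using T0 by blast
      ultimately show ?thesis
        using I.m_inv_closed[OF T0I[of s']] by (simp add: inv_FA)
    qed (use T0 T0I in auto)
    moreover from this have "lclass n (Join s Zer) \<in> I"
      using I_join[of "lclass n s" "lclass n Zer"] I.one_closed by (simp add: join_FA one_FA)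
    moreover have "pprt e = abs_fal (Join s Zer)"
      by (simp add: s(2) abs_fal_simps pprt_def)
    ultimately show ?case
      by (intro bexI[of _ "Join s Zer"]) simp_all
  next
    case zero
    show ?case
      using I.one_closed by (intro bexI[of _ Zer]) (simp_all add: one_FA abs_fal_simps)
  next
    case (add x y)
    then obtain s u where s: "s \<in> lterms n" "lclass n s \<in> I" "x \<le> abs_fal s"
      and u: "u \<in> lterms n" "lclass n u \<in> I" "y \<le> abs_fal u"
      by meson
    then show ?case
      using I.m_closed[OF s(2) u(2)]
      by (intro bexI[of _ "Add s u"]) (simp_all add: mult_FA abs_fal_simps add_mono)
  next
    case (le y x)
    then show ?case by (meson order_trans)
  qed
  have leq_iff: "\<one>\<^bsub>FA n\<^esub> \<preceq>\<^bsub>FA n\<^esub> lclass n s \<otimes>\<^bsub>FA n\<^esub> lclass n t \<longleftrightarrow> - abs_fal t \<le> abs_fal s"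
    if "s \<in> lterms n" for s
    using that t diff_le_eq[of 0 "abs_fal t" "abs_fal s"]
    by (simp add: one_FA mult_FA leq_FA_iff abs_fal_simps)
  show ?thesis
  proof
    assume "\<exists>i \<in> I. \<one>\<^bsub>FA n\<^esub> \<preceq>\<^bsub>FA n\<^esub> i \<otimes>\<^bsub>FA n\<^esub> lclass n t"
    then obtain i where i: "i \<in> I" "\<one>\<^bsub>FA n\<^esub> \<preceq>\<^bsub>FA n\<^esub> i \<otimes>\<^bsub>FA n\<^esub> lclass n t" by blast
    then obtain s where "s \<in> lterms n" "i = lclass n s" "entailed ?E (abs_fal s)"
      using IJ J_cases by blast
    then show "entailed ?E (- abs_fal t)"
      using i(2) leq_iff[of s] by (auto intro: entailed.le[of ?E "abs_fal s"])
  next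
    assume "entailed ?E (- abs_fal t)"
    then show "\<exists>i \<in> I. \<one>\<^bsub>FA n\<^esub> \<preceq>\<^bsub>FA n\<^esub> i \<otimes>\<^bsub>FA n\<^esub> lclass n t"
      using bound leq_iff by blast
  qed
qed

text \<open>The isomorphism is absorbed here: terms evaluated at \<open>g\<close> name all elements
  of \<open>A\<close>, and positivity is read off from finitely many relations, with no further
  reference to the quotient.\<close>

lemma finitely_presentedE:
  assumes A: "comm_lgroup A" and "finitely_presented A"
  obtains n g T where "finite T" "T \<subseteq> lterms n" "\<And>i. g i \<in> carrier A"
    "\<And>a. a \<in> carrier A \<Longrightarrow> \<exists>t \<in> lterms n. comm_lgroup.lterm_eval A g t = a"
    "\<And>t. t \<in> lterms n \<Longrightarrow> \<one>\<^bsub>A\<^esub> \<preceq>\<^bsub>A\<^esub> comm_lgroup.lterm_eval A g t \<longleftrightarrow>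
      entailed (abs_fal ` T) (- abs_fal t)"
proof -
  interpret A: comm_lgroup A by fact
  obtain n I where I: "fin_gen_l_ideal I (FA n)" and iso: "lgroup_isomorphic A (quot_lgroup (FA n) I)"
    using assms(2) by (auto simp: finitely_presented_def)
  obtain S where S: "finite S" "S \<subseteq> carrier (FA n)" "I = (\<lambda>J. l_ideal J (FA n)) hull S"
    using I by (auto simp: fin_gen_l_ideal_def)
  obtain T0 where T0: "T0 \<subseteq> lterms n" "finite T0" "S = lclass n ` T0"
    using finite_subset_image[OF S(1), of "lclass n" "lterms n"] S(2) by (auto simp: carrier_FA)
  define Q where "Q = quot_lgroup (FA n) I"
  obtain h where h: "h \<in> lgroup_hom A Q" "bij_betw h (carrier A) (carrier Q)"
    using iso by (auto simp: lgroup_isomorphic_def Q_def)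
  have ideal: "l_ideal I (FA n)"
    unfolding S(3) by (rule FA.l_ideal_hull[OF S(2)])
  interpret Q: comm_lgroup Q
    unfolding Q_def using FA_comm_lgroup ideal by (rule quot_comm_lgroup)
  interpret h: group_hom A Q h
    using h(1) by unfold_locales (simp add: lgroup_hom_def)
  define \<pi> where "\<pi> x = I #>\<^bsub>FA n\<^esub> x" for x
  have \<pi>: "\<pi> \<in> lgroup_hom (FA n) Q"
    unfolding Q_def \<pi>_def by (rule FA.quot_lgroup_hom[OF ideal])
  have carr_Q: "carrier Q = \<pi> ` carrier (FA n)"
    unfolding Q_def \<pi>_def by (rule FA.quot_carrier[OF ideal])
  \<comment> \<open>The default from \<open>n\<close> on keeps the assignment total in the carrier,
    as \<open>lgroup_hom_lterm_eval\<close> demands.\<close>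
  define c where "c i = (if i < n then lclass n (Gen i) else \<one>\<^bsub>FA n\<^esub>)" for i
  have c: "c i \<in> carrier (FA n)" for i
    by (simp add: c_def carrier_FA one_FA)
  define g where "g i = inv_into (carrier A) h (\<pi> (c i))" for i
  have c_h: "\<pi> (c i) \<in> h ` carrier A" for i
    using c h(2) carr_Q by (auto simp: bij_betw_def)
  have g: "g i \<in> carrier A" "h (g i) = \<pi> (c i)" for i
    unfolding g_def using inv_into_into[OF c_h] f_inv_into_f[OF c_h] by blast+
  have eval_closed: "A.lterm_eval g t \<in> carrier A" for t
    by (rule A.lterm_eval_closed) (rule g(1))
  have h_eval: "h (A.lterm_eval g t) = \<pi> (lclass n t)" if "t \<in> lterms n" for t
  proof -
    have "h (A.lterm_eval g t) = Q.lterm_eval (\<lambda>i. h (g i)) t"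
      using A Q.comm_lgroup_axioms h(1) g(1) by (rule lgroup_hom_lterm_eval)
    also have "\<dots> = Q.lterm_eval (\<lambda>i. \<pi> (c i)) t"
      by (simp add: g(2))
    also have "\<dots> = \<pi> (FA.lterm_eval n c t)"
      using FA_comm_lgroup Q.comm_lgroup_axioms \<pi> c by (rule lgroup_hom_lterm_eval[symmetric])
    also have "FA.lterm_eval n c t = lclass n t"
      using that by (rule lterm_eval_FA) (simp add: c_def)
    finally show ?thesis .
  qed
  show ?thesis
  proof (rule that[of "T0 \<union> Neg ` T0" n g])
    show "finite (T0 \<union> Neg ` T0)" "T0 \<union> Neg ` T0 \<subseteq> lterms n"
      using T0 by auto
    show "g i \<in> carrier A" for i by (rule g)
    show "\<exists>t \<in> lterms n. A.lterm_eval g t = a" if a: "a \<in> carrier A" for a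
    proof -
      have "h a \<in> carrier Q" using a by simp
      then obtain t where t: "t \<in> lterms n" "h a = \<pi> (lclass n t)"
        unfolding carr_Q carrier_FA by blast
      then have "h (A.lterm_eval g t) = h a"
        by (simp add: h_eval)
      then show ?thesis
        using t(1) a eval_closed h(2) by (metis bij_betw_imp_inj_on inj_onD)
    qed
    show "\<one>\<^bsub>A\<^esub> \<preceq>\<^bsub>A\<^esub> A.lterm_eval g t \<longleftrightarrow> entailed (abs_fal ` (T0 \<union> Neg ` T0)) (- abs_fal t)"
      if t: "t \<in> lterms n" for t
    proof -
      have "\<one>\<^bsub>A\<^esub> \<preceq>\<^bsub>A\<^esub> A.lterm_eval g t \<longleftrightarrow> h \<one>\<^bsub>A\<^esub> \<preceq>\<^bsub>Q\<^esub> h (A.lterm_eval g t)"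
        using A Q.comm_lgroup_axioms h(1) bij_betw_imp_inj_on[OF h(2)] A.one_closed eval_closed
        by (rule lgroup_hom_leq_iff)
      also have "\<dots> \<longleftrightarrow> \<pi> \<one>\<^bsub>FA n\<^esub> \<preceq>\<^bsub>Q\<^esub> \<pi> (lclass n t)"
        using h_eval[of Zer] by (simp add: h_eval[OF t] one_FA)
      also have "\<dots> \<longleftrightarrow> (\<exists>i \<in> I. \<one>\<^bsub>FA n\<^esub> \<preceq>\<^bsub>FA n\<^esub> i \<otimes>\<^bsub>FA n\<^esub> lclass n t)"
        unfolding Q_def \<pi>_def
        using t by (intro FA.quot_leq_iff[OF ideal]) (simp_all add: carrier_FA one_FA)
      also have "\<dots> \<longleftrightarrow> entailed (abs_fal ` (T0 \<union> Neg ` T0)) (- abs_fal t)"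
        unfolding S(3) T0(3) by (rule hull_entailed[OF T0(1) t])
      finally show ?thesis .
    qed
  qed
qed

section \<open>Integer combinations as terms, and the submonoid of solutions\<close>

context comm_lgroup
begin

text \<open>Powers in \<open>G\<close> and multiples by \<open>zmul\<close> live in different
  structures; a common term links them.\<close>

lemma lterm_int_pow:
  assumes g: "\<And>i. g i \<in> carrier G" and s: "s \<in> lterms n"
  shows "\<exists>t \<in> lterms n. lterm_eval g t = lterm_eval g s [^] (m::int) \<and> abs_fal t = zmul m (abs_fal s)"
proof -
  have closed: "lterm_eval g t \<in> carrier G" for t
    by (rule lterm_eval_closed) (rule g)
  show ?thesis
  proof (induction m rule: int_induct[where k = 0])
    case base
    show ?case
      by (intro bexI[of _ Zer]) (simp_all add: abs_fal_simps)
  next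
    case (step1 m)
    then obtain t where "t \<in> lterms n" "lterm_eval g t = lterm_eval g s [^] m"
      "abs_fal t = zmul m (abs_fal s)" by blast
    with s show ?case
      by (intro bexI[of _ "Add t s"])
        (simp_all add: abs_fal_simps zmul_add_left int_pow_mult closed)
  next
    case (step2 m)
    then obtain t where "t \<in> lterms n" "lterm_eval g t = lterm_eval g s [^] m"
      "abs_fal t = zmul m (abs_fal s)" by blast
    with s show ?case
      by (intro bexI[of _ "Add t (Neg s)"])
        (simp_all add: abs_fal_simps zmul_diff_one int_pow_diff closed)
  qed
qed

lemma lterm_finprod_int_pow:
  fixes \<xi> :: "nat \<Rightarrow> int"
  assumes g: "\<And>i. g i \<in> carrier G" and s: "\<And>i. i < k \<Longrightarrow> s i \<in> lterms n"
  shows "\<exists>t \<in> lterms n. lterm_eval g t = (\<Otimes>i\<in>{..<k}. lterm_eval g (s i) [^] \<xi> i) \<and>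
    abs_fal t = (\<Sum>i<k. zmul (\<xi> i) (abs_fal (s i)))"
  using s
proof (induction k)
  case 0
  show ?case
    by (intro bexI[of _ Zer]) (simp_all add: abs_fal_simps)
next
  case (Suc k)
  have closed: "lterm_eval g t \<in> carrier G" for t
    by (rule lterm_eval_closed) (rule g)
  obtain t where "t \<in> lterms n" "lterm_eval g t = (\<Otimes>i\<in>{..<k}. lterm_eval g (s i) [^] \<xi> i)"
    "abs_fal t = (\<Sum>i<k. zmul (\<xi> i) (abs_fal (s i)))"
    using Suc.IH Suc.prems by (meson less_Suc_eq)
  moreover obtain u where "u \<in> lterms n" "lterm_eval g u = lterm_eval g (s k) [^] \<xi> k"
    "abs_fal u = zmul (\<xi> k) (abs_fal (s k))"
    using lterm_int_pow[of g "s k" n "\<xi> k"] g Suc.prems[of k] by blast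
  ultimately show ?case
    by (intro bexI[of _ "Add u t"])
      (simp_all add: abs_fal_simps lessThan_Suc closed add.commute)
qed

end

text \<open>The nonnegativity of all coordinates makes this cone pointed, so \<open>gordan\<close>
  applies without cutting into orthants.\<close>

lemma fin_gen_submonoid_cone:
  assumes "finite V"
  shows "fin_gen_submonoid
    {\<xi> \<in> carrier (int_power_group k). (\<forall>i<k. 0 \<le> \<xi> i) \<and> (\<forall>v \<in> V. 0 \<le> pairing k v \<xi>)}
    (int_power_group k)" (is "fin_gen_submonoid ?H _")
proof -
  define W where "W = {x :: nat \<Rightarrow> int. \<forall>i\<ge>k. x i = 0}"
  define F where "F = (\<lambda>i x. x i :: int) ` {..<k} \<union> pairing k ` V"
  have "\<exists>B. finite B \<and> B \<subseteq> {x \<in> W. \<forall>f \<in> F. 0 \<le> f x} \<and> {x \<in> W. \<forall>f \<in> F. 0 \<le> f x} \<subseteq> sums_of B"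
  proof (rule gordan)
    show "finite F" using assms by (simp add: F_def)
    show "f (x - y) = f x - f y" if "f \<in> F" for f x y
      using that by (auto simp: F_def)
    show "x - y \<in> W" if "x \<in> W" "y \<in> W" for x y
      using that by (simp add: W_def)
    show "x = 0" if "x \<in> W" "\<And>f. f \<in> F \<Longrightarrow> f x = 0" for x
    proof
      fix i
      show "x i = 0 i"
        using that(1) that(2)[of "\<lambda>x. x i"] by (cases "i < k") (simp_all add: W_def F_def)
    qed
  qed
  then obtain B where B: "finite B \<and> B \<subseteq> {x \<in> W. \<forall>f \<in> F. 0 \<le> f x} \<and>
    {x \<in> W. \<forall>f \<in> F. 0 \<le> f x} \<subseteq> sums_of B" ..
  \<comment> \<open>Elements of the power group are \<open>undefined\<close> from \<open>k\<close>
    on, those of \<open>W\<close> are 0 there; \<open>r\<close> passes from the second convention to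
    the first.\<close>
  define r where "r x = restrict x {..<k}" for x :: "nat \<Rightarrow> int"
  have r_carr: "r x \<in> carrier (int_power_group k)" for x
    by (simp add: r_def)
  have pairing_r: "pairing k v (r x) = pairing k v x" for v x
    by (rule pairing_cong) (simp add: r_def)
  have r_add: "r (x + y) = r x \<otimes>\<^bsub>int_power_group k\<^esub> r y" for x y
    by (auto simp: r_def)
  have r_zero: "r 0 = \<one>\<^bsub>int_power_group k\<^esub>"
    by (auto simp: r_def)
  have r_H: "r x \<in> ?H \<longleftrightarrow> (\<forall>f \<in> F. 0 \<le> f x)" for x
    using r_carr[of x] by (auto simp: F_def pairing_r) (auto simp: r_def)
  have H_r: "\<exists>x \<in> W. (\<forall>f \<in> F. 0 \<le> f x) \<and> \<xi> = r x" if "\<xi> \<in> ?H" for \<xi>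
  proof -
    define x where "x i = (if i < k then \<xi> i else 0)" for i
    have "\<xi> = r x"
      using that by (auto simp: r_def x_def PiE_def extensional_def fun_eq_iff)
    moreover have "x \<in> W" by (simp add: W_def x_def)
    ultimately show ?thesis using r_H[of x] that by blast
  qed
  have "?H = (\<lambda>K. submonoid K (int_power_group k)) hull (r ` B)"
  proof (rule hull_unique[symmetric])
    show "r ` B \<subseteq> ?H"
      using B r_H by blast
    show "submonoid ?H (int_power_group k)"
    proof
      show "?H \<subseteq> carrier (int_power_group k)" by blast
      show "\<one>\<^bsub>int_power_group k\<^esub> \<in> ?H"
        unfolding r_zero[symmetric] r_H by (auto simp: F_def)
      fix \<xi> \<eta> assume "\<xi> \<in> ?H" "\<eta> \<in> ?H"
      then obtain x y where xy: "\<xi> = r x" "\<eta> = r y" "\<forall>f \<in> F. 0 \<le> f x" "\<forall>f \<in> F. 0 \<le> f y"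
        using H_r by meson
      have "0 \<le> f (x + y)" if f: "f \<in> F" for f
      proof -
        have "f (x + y) = f x + f y"
          using f by (auto simp: F_def)
        then show ?thesis
          using xy(3,4) f by simp
      qed
      then have "\<forall>f \<in> F. 0 \<le> f (x + y)" ..
      then show "\<xi> \<otimes>\<^bsub>int_power_group k\<^esub> \<eta> \<in> ?H"
        unfolding xy(1,2) r_add[symmetric] by (rule r_H[THEN iffD2])
    qed
    fix K assume K: "r ` B \<subseteq> K" "submonoid K (int_power_group k)"
    then interpret K: submonoid K "int_power_group k" by simp
    have sums: "r x \<in> K" if "x \<in> sums_of B" for x
      using that
    proof (induction rule: sums_of.induct)
      case zero
      show ?case unfolding r_zero by (rule K.one_closed)
    next
      case (add b y)
      then show ?case
        unfolding r_add using K(1) by (intro K.m_closed) auto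
    qed
    show "?H \<subseteq> K"
    proof
      fix \<xi> assume "\<xi> \<in> ?H"
      then obtain x where "x \<in> W" "\<forall>f \<in> F. 0 \<le> f x" "\<xi> = r x"
        using H_r by meson
      then show "\<xi> \<in> K" using B sums by blast
    qed
  qed
  moreover have "finite (r ` B)" "r ` B \<subseteq> carrier (int_power_group k)"
    using B r_carr by blast+
  ultimately show ?thesis
    unfolding fin_gen_submonoid_def by blast
qed

theorem theorem8p1:
  fixes A :: "('a, 'b) po_group_scheme"
  assumes "comm_lgroup A" and "finitely_presented A"
  shows "po_coherent A"
  unfolding po_coherent_def
proof (intro allI impI ballI)
  fix k :: nat and a
  assume a: "a \<in> {..<k} \<rightarrow> carrier A"
  interpret A: comm_lgroup A by fact
  obtain n g T where T: "finite T" "T \<subseteq> lterms n" and g: "\<And>i. g i \<in> carrier A"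
    and surj: "\<And>a. a \<in> carrier A \<Longrightarrow> \<exists>t \<in> lterms n. A.lterm_eval g t = a"
    and pos: "\<And>t. t \<in> lterms n \<Longrightarrow> \<one>\<^bsub>A\<^esub> \<preceq>\<^bsub>A\<^esub> A.lterm_eval g t \<longleftrightarrow>
      entailed (abs_fal ` T) (- abs_fal t)"
    using finitely_presentedE[OF assms] by metis
  have "\<forall>i \<in> {..<k}. \<exists>t. t \<in> lterms n \<and> A.lterm_eval g t = a i"
    using surj a by blast
  from bchoice[OF this] obtain s where
    "\<forall>i \<in> {..<k}. s i \<in> lterms n \<and> A.lterm_eval g (s i) = a i" ..
  then have s: "s i \<in> lterms n" "A.lterm_eval g (s i) = a i" if "i < k" for i
    using that by blast+
  \<comment> \<open>Entailment speaks of elements \<le> 0, so positivity is tested on the negated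
    terms.\<close>
  have "\<exists>V. finite V \<and> (\<forall>\<xi>. entailed (abs_fal ` T) (\<Sum>i<k. zmul (\<xi> i) (abs_fal (Neg (s i)))) \<longleftrightarrow>
      (\<forall>z \<in> V. (\<Sum>i<k. \<xi> i * leval z (Neg (s i))) \<le> 0))"
    using T s by (intro entailed_finite_test) simp_all
  then obtain V where V: "finite V" and
    test: "\<And>\<xi>. entailed (abs_fal ` T) (\<Sum>i<k. zmul (\<xi> i) (abs_fal (Neg (s i)))) \<longleftrightarrow>
      (\<forall>z \<in> V. (\<Sum>i<k. \<xi> i * leval z (Neg (s i))) \<le> 0)"
    by (elim exE conjE) (erule that, simp)
  \<comment> \<open>The roles are exchanged: the values of the terms at a test point become the
    coefficients of a linear inequality in \<xi>.\<close>
  define V' where "V' = (\<lambda>z i. leval z (s i)) ` V"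
  have "\<one>\<^bsub>A\<^esub> \<preceq>\<^bsub>A\<^esub> (\<Otimes>\<^bsub>A\<^esub>i\<in>{..<k}. a i [^]\<^bsub>A\<^esub> \<xi> i) \<longleftrightarrow> (\<forall>v \<in> V'. 0 \<le> pairing k v \<xi>)"
    for \<xi> :: "nat \<Rightarrow> int"
  proof -
    obtain t where t: "t \<in> lterms n"
      "A.lterm_eval g t = (\<Otimes>\<^bsub>A\<^esub>i\<in>{..<k}. A.lterm_eval g (s i) [^]\<^bsub>A\<^esub> \<xi> i)"
      "abs_fal t = (\<Sum>i<k. zmul (\<xi> i) (abs_fal (s i)))"
      using A.lterm_finprod_int_pow[of g k s n \<xi>] g s by auto
    have "(\<Otimes>\<^bsub>A\<^esub>i\<in>{..<k}. a i [^]\<^bsub>A\<^esub> \<xi> i) = A.lterm_eval g t"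
      unfolding t(2) using s a by (intro A.finprod_cong') (auto intro!: A.int_pow_closed)
    then have "\<one>\<^bsub>A\<^esub> \<preceq>\<^bsub>A\<^esub> (\<Otimes>\<^bsub>A\<^esub>i\<in>{..<k}. a i [^]\<^bsub>A\<^esub> \<xi> i) \<longleftrightarrow>
        entailed (abs_fal ` T) (\<Sum>i<k. zmul (\<xi> i) (abs_fal (Neg (s i))))"
      using pos[OF t(1)] by (simp add: t(3) abs_fal_simps sum_negf)
    then show ?thesis
      unfolding test by (simp add: V'_def pairing_def sum_negf mult.commute)
  qed
  then show "fin_gen_submonoid
      {\<xi> \<in> carrier (int_power_group k).
        (\<forall>i<k. 0 \<le> \<xi> i) \<and> \<one>\<^bsub>A\<^esub> \<preceq>\<^bsub>A\<^esub> (\<Otimes>\<^bsub>A\<^esub>i\<in>{..<k}. a i [^]\<^bsub>A\<^esub> \<xi> i)}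
      (int_power_group k)"
    using fin_gen_submonoid_cone[of V' k] V by (simp add: V'_def)
qed

end
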